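(* Let $H_i^V$ be the entropy of the triangle $\tau_i^V$ of $T(V)$ containing $x_i$, and let $H(T(I))$ be the entropy of the Delaunay triangulation of $I$, considered as a labeled graph. Then $\sum_{i=1}^n H_i^V=O(n+H(T(I)))$.
   Context: $I=(x_1,\dots,x_n)$ is drawn from a product distribution $\mathcal{D}=\prod_i\mathcal{D}_i$ of planar points in general position inside a bounding triangle. $V$ is the point set from the learning phase. It is a $(1/n)$-net for open disks of the union of $\lceil\log n\rceil$ independent sample inputs, of size $O(n)$, and contains the vertices of the bounding triangle. $T(V)$ is the Delaunay triangulation of $V$. As a standing assumption of the limiting phase, $T(V)$ satisfies: for every triangle $t$ of $T(V)$ with circumdisk $C_t$, the number $X_t$ of input points in $C_t$ has $\mathbf{E}[X_t]=O(1)$ and $\mathbf{E}[X_t^2]=O(1)$. $T(I)$ is the Delaunay triangulation of $I$ as a graph on $\{1,\dots,n\}$. All entropies are Shannon entropies over $I\sim\mathcal{D}$. *)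

theory Defs
  imports "HOL-Probability.Probability"
begin

type_synonym point = "real^2"

definition general_position :: "point set \<Rightarrow> bool" where
  "general_position P \<longleftrightarrow>
     (\<forall>K\<subseteq>P. card K = 3 \<longrightarrow> \<not> collinear K) \<and>
     (\<forall>K\<subseteq>P. card K = 4 \<longrightarrow> \<not> (\<exists>c r. K \<subseteq> sphere c r))"

text \<open>Triangles are represented by their vertex sets.  The circumdisk is the open disk; it is
  well defined for three non-collinear points.\<close>

definition circumdisk :: "point set \<Rightarrow> point set" where
  "circumdisk K = (THE B. \<exists>c r. K \<subseteq> sphere c r \<and> B = ball c r)"

definition delaunay_triangle :: "point set \<Rightarrow> point set \<Rightarrow> bool" where
  "delaunay_triangle P K \<longleftrightarrow>
     K \<subseteq> P \<and> card K = 3 \<and> \<not> collinear K \<and> circumdisk K \<inter> P = {}"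

text \<open>\<open>T\<close> is a set of vertex sets.  Every point of \<open>P\<close> is a vertex of some triangle: it lies in
  a closed triangle of \<open>T\<close>, and a triangle without its vertices is contained in its open
  circumdisk.  If \<open>P\<close> has four cocircular points, \<open>T\<close> need not be unique.\<close>

definition delaunay_triangulation :: "point set \<Rightarrow> point set set \<Rightarrow> bool" where
  "delaunay_triangulation P T \<longleftrightarrow>
     (\<forall>K\<in>T. delaunay_triangle P K) \<and>
     triangulation ((\<lambda>K. convex hull K) ` T) \<and>
     (\<Union>K\<in>T. convex hull K) = convex hull P"

text \<open>The edge set, on the vertex set \<open>{1..n}\<close>, of the Delaunay triangulation of
  \<open>x 1, \<dots>, x n\<close>.  For points in general position the triangles of the unique Delaunay
  triangulation are exactly the sets \<open>K\<close> with \<open>delaunay_triangle (x ` {1..n}) K\<close>.\<close>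

definition delaunay_graph :: "nat \<Rightarrow> (nat \<Rightarrow> point) \<Rightarrow> nat set set" where
  "delaunay_graph n x =
     {{i, j} | i j. i \<in> {1..n} \<and> j \<in> {1..n} \<and> i \<noteq> j \<and>
        (\<exists>K. delaunay_triangle (x ` {1..n}) K \<and> x i \<in> K \<and> x j \<in> K)}"

text \<open>An \<open>\<epsilon>\<close>-net for open disks of the multiset of the points \<open>s j\<close>, \<open>j \<in> J\<close>: points are counted
  with multiplicity, and a disk is heavy if it contains more than an \<open>\<epsilon>\<close>-fraction of them.\<close>

definition disk_net :: "real \<Rightarrow> 'j set \<Rightarrow> ('j \<Rightarrow> point) \<Rightarrow> point set \<Rightarrow> bool" where
  "disk_net \<epsilon> J s N \<longleftrightarrow>
     N \<subseteq> s ` J \<and>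
     (\<forall>c r. real (card {j\<in>J. s j \<in> ball c r}) > \<epsilon> * real (card J) \<longrightarrow> ball c r \<inter> N \<noteq> {})"

text \<open>Shannon entropy in bits of a random variable with finite range; this is the library's
  \<open>\<H>(X)\<close> of locale \<open>information_space\<close> at base 2.\<close>

definition shannon_entropy :: "'a measure \<Rightarrow> ('a \<Rightarrow> 'b) \<Rightarrow> real" where
  "shannon_entropy M X = prob_space.entropy M 2 (count_space (X ` space M)) X"

text \<open>The distribution of the inputs \<open>(x 1, \<dots>, x n)\<close>.\<close>

definition input_dist :: "nat \<Rightarrow> (nat \<Rightarrow> point measure) \<Rightarrow> (nat \<Rightarrow> point) measure" where
  "input_dist n D = PiM {1..n} D"

text \<open>Each coordinate distribution is an arbitrary Borel probability distribution on the plane;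
  almost every input has distinct points, in general position, inside the triangle with
  vertex set \<open>W\<close>.\<close>

definition admissible_dist :: "nat \<Rightarrow> (nat \<Rightarrow> point measure) \<Rightarrow> point set \<Rightarrow> bool" where
  "admissible_dist n D W \<longleftrightarrow>
     card W = 3 \<and> \<not> collinear W \<and>
     (\<forall>i\<in>{1..n}. prob_space (D i) \<and> sets (D i) = sets borel) \<and>
     (AE x in input_dist n D.
        inj_on x {1..n} \<and> general_position (x ` {1..n}) \<and>
        x ` {1..n} \<subseteq> interior (convex hull W))"

text \<open>\<open>V\<close> is a possible result of the learning phase on the realisation \<open>s\<close> of
  \<open>\<lceil>log n\<rceil>\<close> independent inputs, where \<open>s l i\<close> is the \<open>i\<close>-th point of the \<open>l\<close>-th sample input.\<close>

definition learned_from ::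
  "nat \<Rightarrow> (nat \<Rightarrow> point measure) \<Rightarrow> point set \<Rightarrow> (nat \<Rightarrow> nat \<Rightarrow> point) \<Rightarrow> point set \<Rightarrow> bool" where
  "learned_from n D W s V \<longleftrightarrow>
     (let L = {1..nat \<lceil>log 2 (real n)\<rceil>} in
        s \<in> space (PiM L (\<lambda>_. input_dist n D)) \<and>
        (\<forall>l\<in>L. s l ` {1..n} \<subseteq> interior (convex hull W)) \<and>
        (\<exists>N. disk_net (1 / real n) (L \<times> {1..n}) (\<lambda>(l, i). s l i) N \<and> V = N \<union> W))"

definition conflict_count :: "nat \<Rightarrow> point set \<Rightarrow> (nat \<Rightarrow> point) \<Rightarrow> real" where
  "conflict_count n K x = real (card {i\<in>{1..n}. x i \<in> circumdisk K})"

text \<open>\<open>\<tau>\<close> maps a point to the triangle of \<open>T\<close> containing it.  A point on an edge or at a vertex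
  lies in several (closed) triangles; any measurable choice among these is allowed.\<close>

definition point_location :: "point measure \<Rightarrow> point set set \<Rightarrow> (point \<Rightarrow> point set) \<Rightarrow> bool" where
  "point_location \<mu> T \<tau> \<longleftrightarrow>
     \<tau> \<in> measurable \<mu> (count_space T) \<and> (AE p in \<mu>. p \<in> convex hull (\<tau> p))"

end

theory Submission
  imports Defs
begin

text \<open>
  By independence the left-hand side is the entropy of the tuple of all triangles \<open>\<tau>\<^sub>i\<close>, so it
  suffices to describe this tuple, given \<open>T(I)\<close>, by \<open>O(n)\<close> expected bits. A Euclidean minimum
  spanning graph \<open>M\<close> of \<open>I\<close> is a subgraph of \<open>T(I)\<close>, which has \<open>O(n)\<close> edges, so \<open>M\<close> costs \<open>O(n)\<close> bits.
  The triangles of \<open>T(V)\<close> met by an edge of \<open>M\<close> are connected through common sides. Hence all \<open>\<tau>\<^sub>i\<close> are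
  visited by a walk that moves along \<open>M\<close> and across sides of \<open>T(V)\<close>, at a bounded cost per step. Its
  length is proportional to the number of pairs of an edge \<open>x\<^sub>i x\<^sub>j\<close> of \<open>M\<close> and a triangle \<open>t\<close> met by it.
  For such a pair, \<open>C\<^sub>t\<close> contains \<open>x\<^sub>i\<close> or \<open>x\<^sub>j\<close>, or the disk with diameter \<open>[x\<^sub>i, x\<^sub>j]\<close> contains a vertex
  of \<open>t\<close>. The diametral disks of \<open>M\<close> cover each point of the plane only boundedly often, so the
  length is \<open>O(\<Sum>\<^sub>t (X\<^sub>t + 1))\<close>, whose expectation is \<open>O(n)\<close>.
\<close>

section \<open>Entropy and encodings\<close>

text \<open>The length of the walk is controlled only in expectation; for an individual input
  nothing better than the trivial bound by \<open>n\<close> on each conflict count is known. So no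
  uniform code length is available. Instead every tuple gets a weight that decreases geometrically
  with the least cost of describing it, and the entropy is compared with these weights. The decoder
  knows \<open>T(V)\<close> and \<open>T(I)\<close>, but no coordinates of the input, so the walk
  may record combinatorial moves only. Walking along all edges of \<open>T(I)\<close> would not do:
  a vertex of large degree lies in the closed diametral disks of all its edges, and neither the
  overlap nor the number of possible moves would be bounded. Minimality of the spanning graph
  repairs both at once, since the overlap at an input point also bounds the degree there.\<close>

lemma integral_comp_simple_function:
  fixes g :: "'b \<Rightarrow> real"
  assumes "finite_measure M" "simple_function M X"
  shows "integrable M (\<lambda>x. g (X x))"
    and "(\<integral>x. g (X x) \<partial>M) = (\<Sum>v\<in>X ` space M. g v * measure M (X -` {v} \<inter> space M))"
proof -
  interpret finite_measure M by fact
  have fin: "finite (X ` space M)" and sets: "\<And>v. v \<in> X ` space M \<Longrightarrow> X -` {v} \<inter> space M \<in> sets M"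
    using assms(2) by (auto simp: simple_function_def)
  have eq: "g (X x) = (\<Sum>v\<in>X ` space M. g v * indicator (X -` {v} \<inter> space M) x)" if "x \<in> space M" for x
  proof -
    have "(\<Sum>v\<in>X ` space M. g v * indicator (X -` {v} \<inter> space M) x)
        = (\<Sum>v\<in>X ` space M. if v = X x then g v else 0)"
      using that by (intro sum.cong) (auto simp: indicator_def)
    also have "\<dots> = g (X x)" using fin that by simp
    finally show ?thesis by simp
  qed
  have int: "integrable M (\<lambda>x. \<Sum>v\<in>X ` space M. g v * indicator (X -` {v} \<inter> space M) x)"
    using sets by (auto intro!: Bochner_Integration.integrable_sum integrable_mult_right integrable_real_indicator simp: emeasure_eq_measure)
  show "integrable M (\<lambda>x. g (X x))"
    using int by (subst Bochner_Integration.integrable_cong[OF refl eq]) auto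
  have "(\<integral>x. g (X x) \<partial>M) = (\<integral>x. (\<Sum>v\<in>X ` space M. g v * indicator (X -` {v} \<inter> space M) x) \<partial>M)"
    by (intro Bochner_Integration.integral_cong refl eq)
  also have "\<dots> = (\<Sum>v\<in>X ` space M. g v * measure M (X -` {v} \<inter> space M))"
    using sets by (subst Bochner_Integration.integral_sum) (auto intro!: sum.cong integrable_mult_right integrable_real_indicator simp: emeasure_eq_measure)
  finally show "(\<integral>x. g (X x) \<partial>M) = (\<Sum>v\<in>X ` space M. g v * measure M (X -` {v} \<inter> space M))" .
qed

section \<open>Entropy as mean information content\<close>

definition atom_prob :: "'a measure \<Rightarrow> ('a \<Rightarrow> 'b) \<Rightarrow> 'b \<Rightarrow> real" where
  "atom_prob M X v = measure M (X -` {v} \<inter> space M)"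

text \<open>In this form the entropies of several variables can be added and compared pointwise
  under one integral.\<close>

lemma shannon_entropy_eq_integral:
  assumes "prob_space M" "simple_function M X"
  shows "shannon_entropy M X = (\<integral>x. - log 2 (atom_prob M X (X x)) \<partial>M)"
proof -
  interpret information_space M 2
    using assms(1) by (simp add: information_space_def information_space_axioms_def)
  have "shannon_entropy M X = - (\<Sum>v\<in>X ` space M. atom_prob M X v * log 2 (atom_prob M X v))"
    unfolding shannon_entropy_def atom_prob_def
    by (rule entropy_simple_distributed[OF simple_distributedI]) (use assms(2) in auto)
  then show ?thesis
    by (subst integral_comp_simple_function(2)[where g="\<lambda>v. - log 2 (atom_prob M X v)", OF _ assms(2)])
       (auto simp: atom_prob_def sum_negf[symmetric] mult.commute finite_measure_axioms)
qed

lemma shannon_entropy_nonneg: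
  assumes "prob_space M" "simple_function M X"
  shows "shannon_entropy M X \<ge> 0"
proof -
  interpret prob_space M by fact
  have "log 2 (atom_prob M X v) \<le> 0" for v
    unfolding atom_prob_def by (cases "prob (X -` {v} \<inter> space M) = 0")
      (auto simp: log_def divide_le_0_iff zero_less_measure_iff)
  then show ?thesis
    unfolding shannon_entropy_eq_integral[OF assms] by (intro Bochner_Integration.integral_nonneg) auto
qed

text \<open>There are finitely many values of probability 0, so together they are taken on a null
  set only. Up to null sets no logarithm is ever evaluated at 0.\<close>

lemma AE_atom_prob_pos:
  assumes "prob_space M" "simple_function M X"
  shows "AE x in M. atom_prob M X (X x) > 0"
proof -
  interpret prob_space M by fact
  have fin: "finite (X ` space M)" and sets: "\<And>v. v \<in> X ` space M \<Longrightarrow> X -` {v} \<inter> space M \<in> sets M"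
    using assms(2) by (auto simp: simple_function_def)
  have "AE x in M. \<forall>v\<in>X ` space M. atom_prob M X v = 0 \<longrightarrow> x \<notin> X -` {v} \<inter> space M"
    using fin
  proof (subst AE_finite_all, simp, intro ballI)
    fix v assume v: "v \<in> X ` space M"
    show "AE x in M. atom_prob M X v = 0 \<longrightarrow> x \<notin> X -` {v} \<inter> space M"
    proof (cases "atom_prob M X v = 0")
      case True
      then have "X -` {v} \<inter> space M \<in> null_sets M"
        using sets[OF v] by (auto simp: atom_prob_def null_sets_def emeasure_eq_measure)
      then show ?thesis by (auto dest: AE_not_in)
    qed auto
  qed
  then show ?thesis
    using AE_space
  proof eventually_elim
    case (elim x)
    then have "atom_prob M X (X x) \<noteq> 0" by auto
    then show ?case unfolding atom_prob_def by (simp add: zero_less_measure_iff)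
  qed
qed

section \<open>Kraft sums and entropy bounds by counting\<close>

text \<open>At most \<open>K * B ^ k\<close> words have length \<open>k\<close>, so dividing by
  \<open>2 * B\<close> per unit of length instead of \<open>B\<close> leaves the share
  \<open>(1/2) ^ Suc k\<close> for this length, and these shares sum to at most 1.\<close>

lemma kraft_sum_le_1:
  fixes len :: "'b \<Rightarrow> nat" and B K :: real
  assumes "finite S" "B > 0" "K > 0"
    and count: "\<And>k. real (card {y\<in>S. len y \<le> k}) \<le> K * B ^ k"
  shows "(\<Sum>y\<in>S. 1 / (2 * K * (2 * B) ^ len y)) \<le> 1"
proof -
  have "(\<Sum>y\<in>S. 1 / (2 * K * (2 * B) ^ len y))
      = (\<Sum>k\<in>len ` S. \<Sum>y\<in>{y\<in>S. len y = k}. 1 / (2 * K * (2 * B) ^ len y))"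
    using assms(1) by (subst sum.image_gen[where g=len]) auto
  also have "\<dots> = (\<Sum>k\<in>len ` S. real (card {y\<in>S. len y = k}) * (1 / (2 * K * (2 * B) ^ k)))"
    by (intro sum.cong) auto
  also have "\<dots> \<le> (\<Sum>k\<in>len ` S. (1/2) ^ Suc k)"
  proof (intro sum_mono)
    fix k
    have "real (card {y\<in>S. len y = k}) \<le> real (card {y\<in>S. len y \<le> k})"
      using assms(1) by (intro of_nat_mono card_mono) auto
    also have "\<dots> \<le> K * B ^ k" by (rule count)
    finally have "real (card {y\<in>S. len y = k}) * (1 / (2 * K * (2 * B) ^ k))
        \<le> K * B ^ k * (1 / (2 * K * (2 * B) ^ k))"
      using assms by (intro mult_right_mono) auto
    also have "\<dots> = (1/2) ^ Suc k"
      using assms by (simp add: power_mult_distrib field_simps)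
    finally show "real (card {y\<in>S. len y = k}) * (1 / (2 * K * (2 * B) ^ k)) \<le> (1/2) ^ Suc k" .
  qed
  also have "\<dots> \<le> (\<Sum>k. (1/2) ^ Suc k)"
    using assms(1) by (intro sum_le_suminf sums_summable[OF power_half_series]) auto
  also have "\<dots> = 1" using power_half_series by (rule sums_unique[symmetric])
  finally show ?thesis .
qed

text \<open>Gibbs' inequality for the sub-probability \<open>P(G = g) q(g, y)\<close>.\<close>

lemma cross_entropy_bound:
  fixes q :: "'g \<Rightarrow> 'y \<Rightarrow> real"
  assumes "prob_space M" and G: "simple_function M G" and Y: "simple_function M Y"
    and q_nonneg: "\<And>g y. q g y \<ge> 0"
    and q_sum: "\<And>g. g \<in> G ` space M \<Longrightarrow> (\<Sum>y\<in>Y ` space M. q g y) \<le> 1"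
    and q_pos: "AE x in M. q (G x) (Y x) > 0"
  shows "shannon_entropy M Y \<le> shannon_entropy M G + (\<integral>x. - log 2 (q (G x) (Y x)) \<partial>M)"
proof -
  interpret prob_space M by fact
  define Z where "Z = (\<lambda>x. (G x, Y x))"
  have Z: "simple_function M Z"
    unfolding Z_def using G Y by (rule simple_function_Pair)
  let ?pG = "atom_prob M G" and ?pY = "atom_prob M Y" and ?pZ = "atom_prob M Z"
  note intg = integral_comp_simple_function[OF finite_measure_axioms]
  have setsY: "Y -` {v} \<inter> space M \<in> sets M" if "v \<in> Y ` space M" for v
    using Y that by (auto simp: simple_function_def)
  have finG: "finite (G ` space M)" and finY: "finite (Y ` space M)"
    using G Y by (auto simp: simple_function_def)
  \<comment> \<open>\<open>\<phi>\<close> is a likelihood ratio: the weight of a pair in the model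
    over the actual probability of its second component. Its mean is at most 1 because
    \<open>?pZ\<close> is at most \<open>?pY\<close>, and \<open>ln t \<le> t - 1\<close> turns this
    into the entropy inequality.\<close>
  define \<phi> where "\<phi> = (\<lambda>(g, y). ?pG g * q g y / ?pY y)"
  have "(\<integral>x. \<phi> (Z x) \<partial>M) = (\<Sum>v\<in>Z ` space M. \<phi> v * ?pZ v)"
    unfolding atom_prob_def by (rule intg(2)[OF Z])
  also have "\<dots> \<le> (\<Sum>v\<in>Z ` space M. (case v of (g, y) \<Rightarrow> ?pG g * q g y))"
  proof (intro sum_mono)
    fix v assume v: "v \<in> Z ` space M"
    obtain g y where [simp]: "v = (g, y)" by (cases v)
    have y: "y \<in> Y ` space M" using v by (auto simp: Z_def)
    have "?pZ v \<le> ?pY y"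
      unfolding atom_prob_def by (intro finite_measure_mono setsY y) (auto simp: Z_def)
    moreover have "?pY y \<ge> 0" "?pZ v \<ge> 0" by (auto simp: atom_prob_def)
    ultimately have "(?pG g * q g y) * (?pZ v / ?pY y) \<le> (?pG g * q g y) * 1"
      using q_nonneg[of g y] by (intro mult_left_mono) (auto simp: atom_prob_def divide_le_eq_1 zero_less_measure_iff)
    then show "\<phi> v * ?pZ v \<le> (case v of (g, y) \<Rightarrow> ?pG g * q g y)"
      by (simp add: \<phi>_def)
  qed
  also have "\<dots> \<le> (\<Sum>v\<in>G ` space M \<times> Y ` space M. (case v of (g, y) \<Rightarrow> ?pG g * q g y))"
    using finG finY q_nonneg by (intro sum_mono2) (auto simp: Z_def atom_prob_def)
  also have "\<dots> = (\<Sum>g\<in>G ` space M. ?pG g * (\<Sum>y\<in>Y ` space M. q g y))"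
    by (simp add: sum.cartesian_product[symmetric] sum_distrib_left)
  also have "\<dots> \<le> (\<Sum>g\<in>G ` space M. ?pG g * 1)"
    by (intro sum_mono mult_left_mono q_sum) (auto simp: atom_prob_def)
  also have "\<dots> = (\<integral>x. 1 \<partial>M)"
    by (subst intg(2)[OF G, where g="\<lambda>_. 1"]) (simp add: atom_prob_def)
  finally have le1: "(\<integral>x. \<phi> (Z x) \<partial>M) \<le> 1" by (simp add: prob_space)
  define \<psi> where "\<psi> = (\<lambda>(g, y). - log 2 (?pY y) + log 2 (?pG g) + log 2 (q g y))"
  have "(\<integral>x. \<psi> (Z x) \<partial>M) \<le> (\<integral>x. (\<phi> (Z x) - 1) / ln 2 \<partial>M)"
  proof (rule integral_mono_AE)
    show "integrable M (\<lambda>x. \<psi> (Z x))" by (rule intg(1)[OF Z])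
    show "integrable M (\<lambda>x. (\<phi> (Z x) - 1) / ln 2)"
      using intg(1)[OF Z, of "\<lambda>v. (\<phi> v - 1) / ln 2"] .
    show "AE x in M. \<psi> (Z x) \<le> (\<phi> (Z x) - 1) / ln 2"
      using AE_atom_prob_pos[OF assms(1) Y] AE_atom_prob_pos[OF assms(1) G] q_pos
    proof eventually_elim
      case (elim x)
      then have pos: "\<phi> (Z x) > 0" by (simp add: \<phi>_def Z_def)
      have "\<psi> (Z x) = log 2 (\<phi> (Z x))"
        using elim by (simp add: \<psi>_def \<phi>_def Z_def log_mult log_divide)
      also have "\<dots> \<le> (\<phi> (Z x) - 1) / ln 2"
        unfolding log_def using pos by (intro divide_right_mono ln_le_minus_one) auto
      finally show ?case .
    qed
  qed
  also have "\<dots> \<le> 0"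
  proof -
    have "(\<integral>x. (\<phi> (Z x) - 1) / ln 2 \<partial>M) = ((\<integral>x. \<phi> (Z x) \<partial>M) - 1) / ln 2"
      using intg(1)[OF Z, of \<phi>] by (simp add: prob_space)
    then show ?thesis using le1 by (simp add: divide_le_0_iff)
  qed
  finally have "(\<integral>x. \<psi> (Z x) \<partial>M) \<le> 0" .
  moreover have "(\<integral>x. \<psi> (Z x) \<partial>M) = shannon_entropy M Y - shannon_entropy M G
      - (\<integral>x. - log 2 (q (G x) (Y x)) \<partial>M)"
    using intg(1)[OF Y, of "\<lambda>v. - log 2 (?pY v)"] intg(1)[OF G, of "\<lambda>v. - log 2 (?pG v)"]
      intg(1)[OF Z, of "\<lambda>(g, y). log 2 (q g y)"]
    by (simp add: \<psi>_def Z_def shannon_entropy_eq_integral[OF assms(1) Y]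
        shannon_entropy_eq_integral[OF assms(1) G])
  ultimately show ?thesis by simp
qed

text \<open>Turns counting into entropy: the constant \<open>K\<close> costs only its logarithm and
  may thus be exponential in the number of points, while the cost \<open>N\<close> of an outcome
  enters through its mean. Counting is required on the good set \<open>A\<close> only.\<close>

lemma entropy_encoding_bound:
  fixes N :: "'a \<Rightarrow> nat" and B K :: real
  assumes "prob_space M" and G: "simple_function M G" and Y: "simple_function M Y"
    and good: "AE x in M. x \<in> A"
    and BK: "B \<ge> 1" "K \<ge> 1"
    and N: "integrable M (\<lambda>x. real (N x))"
    and count: "\<And>g k. real (card {y. \<exists>x\<in>A. G x = g \<and> Y x = y \<and> N x \<le> k}) \<le> K * B ^ k"
    and fin: "\<And>g k. finite {y. \<exists>x\<in>A. G x = g \<and> Y x = y \<and> N x \<le> k}"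
  shows "shannon_entropy M Y
    \<le> shannon_entropy M G + (1 + log 2 K + log 2 (2 * B) * (\<integral>x. real (N x) \<partial>M))"
proof -
  interpret prob_space M by fact
  define S where "S g = {y. \<exists>x\<in>A. G x = g \<and> Y x = y}" for g
  \<comment> \<open>Inputs with the same graph and tuple may have different costs, but a weight may
    depend on the pair \<open>(g, y)\<close> only. The least cost is attained, so
    \<open>count\<close> applies to it, and it never exceeds \<open>N x\<close>.\<close>
  define len where "len g y = (LEAST k. \<exists>x\<in>A. G x = g \<and> Y x = y \<and> N x = k)" for g y
  define q where "q g y = (if y \<in> S g then 1 / (2 * K * (2 * B) ^ len g y) else 0)" for g y
  have len_attained: "\<exists>x\<in>A. G x = g \<and> Y x = y \<and> N x = len g y" if "y \<in> S g" for g y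
  proof -
    have "\<exists>k. \<exists>x\<in>A. G x = g \<and> Y x = y \<and> N x = k" using that by (auto simp: S_def)
    then show ?thesis unfolding len_def by (rule LeastI_ex)
  qed
  have len_le: "len (G x) (Y x) \<le> N x" if "x \<in> A" for x
    unfolding len_def using that by (intro Least_le) auto
  have finY: "finite (Y ` space M)" using Y by (auto simp: simple_function_def)
  have "shannon_entropy M Y \<le> shannon_entropy M G + (\<integral>x. - log 2 (q (G x) (Y x)) \<partial>M)"
  proof (rule cross_entropy_bound[OF assms(1) G Y])
    show "q g y \<ge> 0" for g y using BK by (simp add: q_def)
    show "AE x in M. q (G x) (Y x) > 0"
      using good by eventually_elim (use BK in \<open>auto simp: q_def S_def\<close>)
    show "(\<Sum>y\<in>Y ` space M. q g y) \<le> 1" for g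
    proof -
      have "(\<Sum>y\<in>Y ` space M. q g y)
          = (\<Sum>y\<in>Y ` space M \<inter> S g. 1 / (2 * K * (2 * B) ^ len g y))"
        using finY unfolding q_def by (simp only: sum.inter_restrict)
      also have "\<dots> \<le> 1"
      proof (rule kraft_sum_le_1)
        show "finite (Y ` space M \<inter> S g)" using finY by simp
        show "B > 0" "K > 0" using BK by auto
        fix k
        have "card {y \<in> Y ` space M \<inter> S g. len g y \<le> k}
            \<le> card {y. \<exists>x\<in>A. G x = g \<and> Y x = y \<and> N x \<le> k}"
          using len_attained[of _ g] by (intro card_mono fin) fastforce
        then show "real (card {y \<in> Y ` space M \<inter> S g. len g y \<le> k}) \<le> K * B ^ k"
          using count[of g k] by linarith
      qed
      finally show ?thesis .
    qed
  qed
  also have "(\<integral>x. - log 2 (q (G x) (Y x)) \<partial>M)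
      \<le> (\<integral>x. 1 + log 2 K + log 2 (2 * B) * real (N x) \<partial>M)"
  proof (rule integral_mono_AE)
    show "integrable M (\<lambda>x. - log 2 (q (G x) (Y x)))"
      using integral_comp_simple_function(1)[OF finite_measure_axioms simple_function_Pair[OF G Y],
          of "\<lambda>(g, y). - log 2 (q g y)"] by simp
    show "integrable M (\<lambda>x. 1 + log 2 K + log 2 (2 * B) * real (N x))"
      using N by simp
    show "AE x in M. - log 2 (q (G x) (Y x)) \<le> 1 + log 2 K + log 2 (2 * B) * real (N x)"
      using good
    proof eventually_elim
      case (elim x)
      have "- log 2 (q (G x) (Y x)) = log 2 (2 * K * (2 * B) ^ len (G x) (Y x))"
        using elim BK by (auto simp: q_def S_def log_divide)
      also have "\<dots> = 1 + log 2 K + real (len (G x) (Y x)) * log 2 (2 * B)"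
        using BK by (simp add: log_mult log_nat_power distrib_left)
      also have "\<dots> \<le> 1 + log 2 K + real (N x) * log 2 (2 * B)"
        using len_le[OF elim] BK by (intro add_left_mono mult_right_mono) auto
      finally show ?case by (simp add: mult.commute)
    qed
  qed
  also have "\<dots> = 1 + log 2 K + log 2 (2 * B) * (\<integral>x. real (N x) \<partial>M)"
    using N by (simp add: prob_space)
  finally show ?thesis by simp
qed

text \<open>The atoms of the tuple are intersections of atoms of the components. By independence
  their probabilities multiply, so the information contents add up pointwise, outside a null set
  where a factor vanishes.\<close>

lemma sum_entropy_indep:
  assumes "prob_space M" "finite I" "I \<noteq> {}"
    and X: "\<And>i. i \<in> I \<Longrightarrow> simple_function M (X i)"
    and indep: "prob_space.indep_vars M (\<lambda>_. count_space UNIV) X I"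
  shows "(\<Sum>i\<in>I. shannon_entropy M (X i)) = shannon_entropy M (\<lambda>x. \<lambda>i\<in>I. X i x)"
    and "simple_function M (\<lambda>x. \<lambda>i\<in>I. X i x)"
proof -
  interpret prob_space M by fact
  let ?Y = "\<lambda>x. \<lambda>i\<in>I. X i x"
  have vimage: "?Y -` {?Y x} \<inter> space M = (\<Inter>i\<in>I. X i -` {X i x} \<inter> space M)" for x
    using assms(3) by (auto simp: fun_eq_iff restrict_def) metis+
  show Y: "simple_function M ?Y"
    unfolding simple_function_def
  proof (intro conjI ballI)
    have "?Y ` space M \<subseteq> PiE I (\<lambda>i. X i ` space M)" by auto
    moreover have "finite (PiE I (\<lambda>i. X i ` space M))"
      using X assms(2) by (intro finite_PiE) (auto simp: simple_function_def)
    ultimately show "finite (?Y ` space M)" by (rule finite_subset)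
    fix y assume "y \<in> ?Y ` space M"
    then obtain x where "y = ?Y x" "x \<in> space M" by auto
    then show "?Y -` {y} \<inter> space M \<in> sets M"
      using X assms(2,3) by (simp only: vimage) (intro sets.finite_INT, auto simp: simple_function_def)
  qed
  have prod: "atom_prob M ?Y (?Y x) = (\<Prod>i\<in>I. atom_prob M (X i) (X i x))" for x
    unfolding atom_prob_def vimage
    using indep_varsD[OF indep assms(3,2) order_refl, of "\<lambda>i. {X i x}"] by simp
  have "shannon_entropy M ?Y = (\<integral>x. (\<Sum>i\<in>I. - log 2 (atom_prob M (X i) (X i x))) \<partial>M)"
    unfolding shannon_entropy_eq_integral[OF assms(1) Y]
  proof (rule integral_cong_AE)
    show "(\<lambda>x. - log 2 (atom_prob M ?Y (?Y x))) \<in> borel_measurable M"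
      using integral_comp_simple_function(1)[OF finite_measure_axioms Y, of "\<lambda>v. - log 2 (atom_prob M ?Y v)"]
      by (rule borel_measurable_integrable)
    show "(\<lambda>x. \<Sum>i\<in>I. - log 2 (atom_prob M (X i) (X i x))) \<in> borel_measurable M"
      using integral_comp_simple_function(1)[OF finite_measure_axioms X]
      by (intro borel_measurable_sum borel_measurable_integrable)
         (auto intro!: integral_comp_simple_function(1)[OF finite_measure_axioms X, where g="\<lambda>v. - log 2 (atom_prob M _ v)"])
    show "AE x in M. - log 2 (atom_prob M ?Y (?Y x)) = (\<Sum>i\<in>I. - log 2 (atom_prob M (X i) (X i x)))"
    proof -
      have "AE x in M. \<forall>i\<in>I. atom_prob M (X i) (X i x) > 0"
        using AE_atom_prob_pos[OF assms(1) X] assms(2) by (simp add: AE_finite_all)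
      then show ?thesis
      proof eventually_elim
        case (elim x)
        then have "log 2 (\<Prod>i\<in>I. atom_prob M (X i) (X i x)) = (\<Sum>i\<in>I. log 2 (atom_prob M (X i) (X i x)))"
          unfolding log_def by (subst ln_prod) (auto simp: sum_divide_distrib assms(2))
        then show ?case by (simp only: prod sum_negf)
      qed
    qed
  qed
  also have "\<dots> = (\<Sum>i\<in>I. shannon_entropy M (X i))"
    by (subst Bochner_Integration.integral_sum)
       (auto simp: shannon_entropy_eq_integral[OF assms(1) X]
        intro!: integral_comp_simple_function(1)[OF finite_measure_axioms X, where g="\<lambda>v. log 2 (atom_prob M _ v)"])
  finally show "(\<Sum>i\<in>I. shannon_entropy M (X i)) = shannon_entropy M ?Y" by simp
qed

section \<open>Minimum spanning graphs and their diametral disks\<close>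

text \<open>Breaks ties: general position does not exclude equal distances, while Kruskal's rule
  needs a strict total order on the edges. The induction adds elements in nondecreasing order of
  \<open>f\<close>, so a new one may be ranked above all earlier ones.\<close>

lemma ex_injective_ranking:
  fixes f :: "'a \<Rightarrow> real"
  assumes "finite E"
  shows "\<exists>r::'a \<Rightarrow> nat. inj_on r E \<and> (\<forall>e\<in>E. \<forall>e'\<in>E. f e < f e' \<longrightarrow> r e < r e')"
  using assms
proof (induction rule: finite_ranking_induct[where f=f])
  case (insert x S)
  then obtain r :: "'a \<Rightarrow> nat" where r: "inj_on r S" "\<forall>e\<in>S. \<forall>e'\<in>S. f e < f e' \<longrightarrow> r e < r e'"
    by blast
  show ?case
  proof (cases "x \<in> S")
    case True
    then show ?thesis using r by (auto simp: insert_absorb)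
  next
    case False
    define r' where "r' = r(x := Suc (Max (insert 0 (r ` S))))"
    have less: "r e < Suc (Max (insert 0 (r ` S)))" if "e \<in> S" for e
      using insert.hyps that by (simp add: less_Suc_eq_le)
    have "inj_on r' S"
      using r(1) False by (subst inj_on_cong[of S r' r]) (auto simp: r'_def)
    moreover have "r' x \<notin> r' ` (S - {x})"
    proof
      assume "r' x \<in> r' ` (S - {x})"
      then obtain y where "y \<in> S" "r' x = r y" by (auto simp: r'_def)
      then show False using less[of y] by (simp add: r'_def)
    qed
    ultimately have "inj_on r' (insert x S)" by simp
    moreover have "\<forall>e\<in>insert x S. \<forall>e'\<in>insert x S. f e < f e' \<longrightarrow> r' e < r' e'"
      using r(2) less False by (force simp: r'_def dest: insert.hyps(2))
    ultimately show ?thesis by blast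
  qed
qed simp

text \<open>Exchange property of minimum spanning trees: otherwise the longer edge could be replaced
  by a detour through the other one. The disjuncts \<open>i = k\<close> and \<open>j = l\<close> are
  there because \<open>d\<close> is arbitrary and \<open>d i i\<close> need not be small.\<close>

definition no_close_edges :: "('i \<Rightarrow> 'i \<Rightarrow> real) \<Rightarrow> 'i set set \<Rightarrow> bool" where
  "no_close_edges d M \<longleftrightarrow>
    (\<forall>i j k l. {i, j} \<in> M \<longrightarrow> {k, l} \<in> M \<longrightarrow> {i, j} \<noteq> {k, l} \<longrightarrow>
       (i = k \<or> d i k < max (d i j) (d k l)) \<longrightarrow> \<not> (j = l \<or> d j l < max (d i j) (d k l)))"

text \<open>Kruskal's criterion: keep an edge iff its endpoints are not joined by a path of edges of
  smaller rank.\<close>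

lemma ex_spanning_graph:
  fixes d :: "'i \<Rightarrow> 'i \<Rightarrow> real"
  assumes "finite I" and sym: "\<And>i j. d i j = d j i"
  obtains M where "M \<subseteq> {{i, j} | i j. i \<in> I \<and> j \<in> I \<and> i \<noteq> j}"
    "\<And>i j. i \<in> I \<Longrightarrow> j \<in> I \<Longrightarrow> (i, j) \<in> {(i, j). {i, j} \<in> M}\<^sup>*"
    "\<And>i j k. {i, j} \<in> M \<Longrightarrow> k \<in> I \<Longrightarrow> k \<noteq> i \<Longrightarrow> k \<noteq> j \<Longrightarrow> \<not> (d i k < d i j \<and> d j k < d i j)"
    "no_close_edges d M"
proof -
  define E where "E = {{i, j} | i j. i \<in> I \<and> j \<in> I \<and> i \<noteq> j}"
  have "finite E"
    using assms(1) by (intro finite_subset[of E "Pow I"]) (auto simp: E_def)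
  define w where "w e = (let (i, j) = (SOME (i, j). e = {i, j}) in d i j)" for e
  have w: "w {i, j} = d i j" for i j
  proof -
    have "case (SOME (k, l). {i, j} = {k, l}) of (k, l) \<Rightarrow> {i, j} = {k, l}"
      by (rule someI[of "\<lambda>(k, l). {i, j} = {k, l}" "(i, j)"]) simp
    then show ?thesis
      unfolding w_def by (auto simp: doubleton_eq_iff sym split: prod.splits)
  qed
  obtain r :: "'i set \<Rightarrow> nat" where r: "inj_on r E"
    and r_mono: "\<And>e e'. e \<in> E \<Longrightarrow> e' \<in> E \<Longrightarrow> w e < w e' \<Longrightarrow> r e < r e'"
    using ex_injective_ranking[OF \<open>finite E\<close>, of w] by blast
  define smaller where "smaller e = {(i, j). {i, j} \<in> E \<and> r {i, j} < r e}" for e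
  define M where "M = {e\<in>E. \<forall>i j. e = {i, j} \<longrightarrow> (i, j) \<notin> (smaller e)\<^sup>*}"
  have smaller_sym: "(i, j) \<in> (smaller e)\<^sup>* \<longleftrightarrow> (j, i) \<in> (smaller e)\<^sup>*" for i j e
  proof -
    have "sym (smaller e)" by (auto simp: sym_def smaller_def insert_commute)
    then show ?thesis by (meson sym_rtrancl symE)
  qed
  have E_iff: "{i, j} \<in> E \<longleftrightarrow> i \<in> I \<and> j \<in> I \<and> i \<noteq> j" for i j
    by (auto simp: E_def doubleton_eq_iff)
  have ME: "M \<subseteq> E" by (auto simp: M_def)
  have edge: "(i, j) \<in> {(i, j). {i, j} \<in> M}\<^sup>*" if "{i, j} \<in> E" for i j
    using that
  proof (induction "r {i, j}" arbitrary: i j rule: less_induct)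
    case less
    show ?case
    proof (cases "{i, j} \<in> M")
      case False
      then have "(i, j) \<in> (smaller {i, j})\<^sup>*"
        using less.prems smaller_sym by (auto simp: M_def doubleton_eq_iff insert_commute)
      moreover have "smaller {i, j} \<subseteq> {(i, j). {i, j} \<in> M}\<^sup>*"
        using less.hyps by (auto simp: smaller_def)
      ultimately show ?thesis
        using rtrancl_subset_rtrancl by blast
    qed auto
  qed
  have conn: "(i, j) \<in> {(i, j). {i, j} \<in> M}\<^sup>*" if "i \<in> I" "j \<in> I" for i j
    using that edge[of i j] by (cases "i = j") (auto simp: E_iff)
  have smallerI: "(a, b) \<in> (smaller {i, j})\<^sup>*"
    if "a \<in> I" "b \<in> I" "a = b \<or> d a b < d i j" "{i, j} \<in> E" for a b i j
  proof (cases "a = b")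
    case False
    then have "{a, b} \<in> E" using that by (simp add: E_iff)
    then have "(a, b) \<in> smaller {i, j}"
      using False that r_mono[of "{a, b}" "{i, j}"] by (simp add: smaller_def w)
    then show ?thesis by auto
  qed auto
  have lune: False
    if "{i, j} \<in> M" "k \<in> I" "k \<noteq> i" "k \<noteq> j" "d i k < d i j" "d j k < d i j" for i j k
  proof -
    have e: "{i, j} \<in> E" using that ME by auto
    have "(i, k) \<in> (smaller {i, j})\<^sup>*" "(k, j) \<in> (smaller {i, j})\<^sup>*"
      using that e sym[of j k] by (auto intro!: smallerI simp: E_iff)
    then have "(i, j) \<in> (smaller {i, j})\<^sup>*" by (rule rtrancl_trans)
    then show False using that(1) by (auto simp: M_def)
  qed
  \<comment> \<open>The path \<open>i\<close>, \<open>k\<close>, \<open>l\<close>, \<open>j\<close>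
    has smaller ranks only: the edge of larger rank is not the shorter one, so
    \<open>max (d i j) (d k l)\<close> is \<open>d i j\<close>.\<close>
  have two: False
    if "{i, j} \<in> M" "{k, l} \<in> M" "r {k, l} < r {i, j}"
      "i = k \<or> d i k < max (d i j) (d k l)" "j = l \<or> d j l < max (d i j) (d k l)" for i j k l
  proof -
    have e: "{i, j} \<in> E" "{k, l} \<in> E" using that ME by auto
    have "\<not> d i j < d k l" using r_mono[of "{i, j}" "{k, l}"] e that(3) by (auto simp: w)
    then have m: "max (d i j) (d k l) = d i j" by auto
    have "(i, k) \<in> (smaller {i, j})\<^sup>*" "(l, j) \<in> (smaller {i, j})\<^sup>*"
      using that e sym[of j l] m by (auto intro!: smallerI simp: E_iff)
    moreover have "(k, l) \<in> (smaller {i, j})\<^sup>*"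
      using that(3) e by (auto simp: smaller_def)
    ultimately have "(i, j) \<in> (smaller {i, j})\<^sup>*" by (meson rtrancl_trans)
    then show False using that(1) by (auto simp: M_def)
  qed
  have "no_close_edges d M"
    unfolding no_close_edges_def
  proof (intro allI impI notI)
    fix i j k l
    assume *: "{i, j} \<in> M" "{k, l} \<in> M" "{i, j} \<noteq> {k, l}"
       "i = k \<or> d i k < max (d i j) (d k l)" "j = l \<or> d j l < max (d i j) (d k l)"
    have "r {i, j} \<noteq> r {k, l}" using r ME * by (auto dest!: inj_onD)
    then consider "r {k, l} < r {i, j}" | "r {i, j} < r {k, l}" by linarith
    then show False
      using two[of i j k l] two[of k l i j] * sym by cases (auto simp: max.commute)
  qed
  then show thesis
    using that[OF ME[unfolded E_def] conn] lune by blast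
qed

section \<open>Bounded overlap of diametral disks\<close>

text \<open>Directions in one ball of radius 1/2 enclose an angle below 60 degrees, and the side
  opposite to such an angle is not the longest side of a triangle. Compactness of the sphere leaves
  finitely many balls; \<open>c\<close> names the one chosen for a direction.\<close>

lemma ex_narrow_sectors:
  "\<exists>(c :: 'a :: euclidean_space \<Rightarrow> 'a) F. finite F \<and> range c \<subseteq> F \<and>
    (\<forall>u w. u \<noteq> 0 \<longrightarrow> w \<noteq> 0 \<longrightarrow> c u = c w \<longrightarrow> norm (u - w) < max (norm u) (norm w))"
proof -
  have "compact (sphere (0::'a) 1)" by simp
  then obtain F where F: "finite F" "sphere 0 1 \<subseteq> (\<Union>c\<in>F. ball (c::'a) (1/2))"
    by (rule compactE_image[of _ "sphere 0 1" "\<lambda>c. ball c (1/2)"]) auto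
  define c where "c u = (SOME c. c \<in> insert 0 F \<and> (u \<noteq> 0 \<longrightarrow> sgn u \<in> ball c (1/2)))" for u
  have c: "c u \<in> insert 0 F \<and> (u \<noteq> 0 \<longrightarrow> sgn u \<in> ball (c u) (1/2))" for u
    unfolding c_def
  proof (rule someI_ex, cases "u = 0")
    case False
    then have "sgn u \<in> sphere 0 1" by (simp add: norm_sgn)
    then show "\<exists>c. c \<in> insert 0 F \<and> (u \<noteq> 0 \<longrightarrow> sgn u \<in> ball c (1/2))" using F(2) by blast
  qed auto
  have "norm (u - w) < max (norm u) (norm w)" if "u \<noteq> 0" "w \<noteq> 0" "c u = c w" for u w
  proof -
    have "dist (sgn u) (sgn w) < 1"
      using c[of u] c[of w] that dist_triangle_half_r[of "c u" "sgn u" 1 "sgn w"] by simp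
    then have "(dist (sgn u) (sgn w))\<^sup>2 < 1"
      by (simp add: power_less_one_iff)
    moreover have "sgn u \<bullet> sgn u = 1" "sgn w \<bullet> sgn w = 1"
      using that by (simp_all add: norm_eq_1[symmetric] norm_sgn)
    ultimately have "1 + 1 - 2 * (sgn u \<bullet> sgn w) < 1"
      by (simp add: dist_norm power2_norm_eq_inner inner_diff inner_commute)
    then have "sgn u \<bullet> sgn w > 1/2" by simp
    then have "(norm u * norm w) * (sgn u \<bullet> sgn w) > (norm u * norm w) * (1/2)"
      using that by (intro mult_strict_left_mono) auto
    moreover have "(norm u * norm w) * (sgn u \<bullet> sgn w) = u \<bullet> w"
      using that by (simp add: sgn_div_norm field_simps)
    ultimately have "2 * (u \<bullet> w) > norm u * norm w" by simp
    then have "(norm (u - w))\<^sup>2 < (norm u)\<^sup>2 + (norm w)\<^sup>2 - norm u * norm w"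
      by (simp add: power2_norm_eq_inner inner_diff inner_commute)
    also have "\<dots> \<le> (max (norm u) (norm w))\<^sup>2"
    proof (cases "norm u \<le> norm w")
      case True
      then have "norm u * norm u \<le> norm u * norm w" by (intro mult_left_mono) auto
      then show ?thesis using True by (simp add: max_def power2_eq_square)
    next
      case False
      then have "norm w * norm w \<le> norm u * norm w" by (intro mult_right_mono) auto
      then show ?thesis using False by (simp add: max_def power2_eq_square)
    qed
    finally show ?thesis by (rule power_less_imp_less_base) (simp add: max_def)
  qed
  then show ?thesis
    using F(1) c by (intro exI[of _ c] exI[of _ "insert 0 F"]) auto
qed

text \<open>The closed disk with diameter \<open>[x, y]\<close> is the set of all \<open>v\<close> with
  \<open>(x - v) \<bullet> (y - v) \<le> 0\<close>, and \<open>(x - v) \<bullet> (y - v)\<close> is the power of \<open>v\<close> with respect to it.\<close>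

lemma dist_less_of_inner_nonpos:
  fixes x y v :: "'a :: real_inner"
  assumes "(x - v) \<bullet> (y - v) \<le> 0" "y \<noteq> v"
  shows "dist x v < dist x y"
proof -
  have "(dist x y)\<^sup>2 = (dist x v)\<^sup>2 + (dist y v)\<^sup>2 - 2 * ((x - v) \<bullet> (y - v))"
    by (simp add: dist_norm power2_norm_eq_inner inner_diff inner_commute)
  moreover have "(dist y v)\<^sup>2 > 0" using assms(2) by simp
  ultimately have "(dist x v)\<^sup>2 < (dist x y)\<^sup>2" using assms(1) by linarith
  then show ?thesis by (rule power_less_imp_less_base) simp
qed

text \<open>Two edges whose diametral disks contain \<open>v\<close> and whose endpoints lie in the same narrow sectors
  around \<open>v\<close> are close to each other.\<close>

lemma ex_ply_bound:
  "\<exists>\<Delta>. \<forall>(x :: 'i \<Rightarrow> 'a :: euclidean_space) M v.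
    M \<subseteq> {{i, j} | i j. x i \<noteq> x j} \<longrightarrow>
    no_close_edges (\<lambda>i j. dist (x i) (x j)) M \<longrightarrow>
    finite {e\<in>M. \<exists>i j. e = {i, j} \<and> (x i - v) \<bullet> (x j - v) \<le> 0} \<and>
    card {e\<in>M. \<exists>i j. e = {i, j} \<and> (x i - v) \<bullet> (x j - v) \<le> 0} \<le> \<Delta>"
proof -
  obtain c :: "'a \<Rightarrow> 'a" and F where F: "finite F" "range c \<subseteq> F"
    and c: "\<And>u w. u \<noteq> 0 \<Longrightarrow> w \<noteq> 0 \<Longrightarrow> c u = c w \<Longrightarrow> norm (u - w) < max (norm u) (norm w)"
    using ex_narrow_sectors by blast
  show ?thesis
  proof (intro exI[of _ "card (F \<times> F)"] allI impI)
    fix x :: "'i \<Rightarrow> 'a" and M v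
    assume M: "M \<subseteq> {{i, j} | i j. x i \<noteq> x j}"
      and "no_close_edges (\<lambda>i j. dist (x i) (x j)) M"
    then have two: "\<forall>i j k l. {i, j} \<in> M \<longrightarrow> {k, l} \<in> M \<longrightarrow> {i, j} \<noteq> {k, l} \<longrightarrow>
       (i = k \<or> dist (x i) (x k) < max (dist (x i) (x j)) (dist (x k) (x l))) \<longrightarrow>
       \<not> (j = l \<or> dist (x j) (x l) < max (dist (x i) (x j)) (dist (x k) (x l)))"
      by (simp add: no_close_edges_def)
    define E where "E = {e\<in>M. \<exists>i j. e = {i, j} \<and> (x i - v) \<bullet> (x j - v) \<le> 0}"
    \<comment> \<open>At most one endpoint is \<open>v\<close>. Orienting the edge so that this can
      only be the first one makes the distance estimate \<open>pless\<close> strict.\<close>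
    have "\<exists>i j. e = {i, j} \<and> (x i - v) \<bullet> (x j - v) \<le> 0 \<and> x j \<noteq> v" if e: "e \<in> E" for e
    proof -
      obtain i j where ij: "e = {i, j}" "(x i - v) \<bullet> (x j - v) \<le> 0" using e by (auto simp: E_def)
      moreover have "x i \<noteq> x j"
        using M e ij(1) by (fastforce simp: E_def doubleton_eq_iff)
      ultimately show ?thesis
        by (cases "x j = v") (metis insert_commute inner_commute)+
    qed
    then obtain p q where pq: "\<And>e. e \<in> E \<Longrightarrow> e = {p e, q e}"
      and pq_inner: "\<And>e. e \<in> E \<Longrightarrow> (x (p e) - v) \<bullet> (x (q e) - v) \<le> 0"
      and q: "\<And>e. e \<in> E \<Longrightarrow> x (q e) \<noteq> v"
      by metis
    have inj: "inj_on (\<lambda>e. (c (x (p e) - v), c (x (q e) - v))) E"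
    proof (rule inj_onI, rule ccontr)
      fix e f assume ef: "e \<in> E" "f \<in> E" "e \<noteq> f"
        "(c (x (p e) - v), c (x (q e) - v)) = (c (x (p f) - v), c (x (q f) - v))"
      let ?m = "max (dist (x (p e)) (x (q e))) (dist (x (p f)) (x (q f)))"
      have close: "dist a b < max (dist a v) (dist b v)" if "a \<noteq> v" "b \<noteq> v" "c (a - v) = c (b - v)" for a b
        using c[of "a - v" "b - v"] that by (simp add: dist_norm)
      have pless: "dist (x (p g)) v < dist (x (p g)) (x (q g))" if "g \<in> E" for g
        using pq_inner[OF that] q[OF that] by (rule dist_less_of_inner_nonpos)
      have qle: "dist (x (q g)) v \<le> dist (x (p g)) (x (q g))" if "g \<in> E" for g
      proof (cases "x (p g) = v")
        case False
        then show ?thesis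
          using dist_less_of_inner_nonpos[of "x (q g)" v "x (p g)"] pq_inner[OF that]
          by (simp add: inner_commute dist_commute)
      qed (simp add: dist_commute)
      have "dist (x (q e)) (x (q f)) < ?m"
        using close[of "x (q e)" "x (q f)"] q ef qle[OF ef(1)] qle[OF ef(2)] by auto
      moreover have "p e = p f \<or> dist (x (p e)) (x (p f)) < ?m"
      proof -
        have "dist (x (p e)) (x (p f)) < ?m"
        \<comment> \<open>A sector is meaningful only for points different from \<open>v\<close>. If
          one of the two is \<open>v\<close>, their distance is the distance of the other from
          \<open>v\<close>, and \<open>pless\<close> is enough.\<close>
        proof (cases "x (p e) = v \<or> x (p f) = v")
          case True
          then show ?thesis
            using pless[OF ef(1)] pless[OF ef(2)] by (auto simp: dist_commute less_max_iff_disj)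
        next
          case False
          then show ?thesis
            using close[of "x (p e)" "x (p f)"] ef pless[OF ef(1)] pless[OF ef(2)] by auto
        qed
        then show ?thesis by simp
      qed
      moreover have "{p e, q e} \<in> M" "{p f, q f} \<in> M" "{p e, q e} \<noteq> {p f, q f}"
        using ef pq[of e] pq[of f] by (auto simp: E_def)
      ultimately show False using two by blast
    qed
    have sub: "(\<lambda>e. (c (x (p e) - v), c (x (q e) - v))) ` E \<subseteq> F \<times> F" using F by auto
    show "finite {e\<in>M. \<exists>i j. e = {i, j} \<and> (x i - v) \<bullet> (x j - v) \<le> 0} \<and>
      card {e\<in>M. \<exists>i j. e = {i, j} \<and> (x i - v) \<bullet> (x j - v) \<le> 0} \<le> card (F \<times> F)"
      using inj_on_finite[OF inj sub] card_inj_on_le[OF inj sub] F(1) unfolding E_def by simp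
  qed
qed

section \<open>Planar triangles and circumdisks\<close>

lemma power_nonneg_iff:
  fixes u c :: "'a :: real_inner"
  assumes "r \<ge> 0"
  shows "u \<notin> ball c r \<longleftrightarrow> (u - c) \<bullet> (u - c) \<ge> r\<^sup>2"
  using assms by (simp add: dist_norm norm_minus_commute power2_norm_eq_inner[symmetric] not_less abs_le_square_iff)

text \<open>The difference of the powers of a point with respect to the circumscribed disk and to the
  disk with diameter \<open>[x, y]\<close> is affine: nonnegative at \<open>x\<close> and \<open>y\<close>, and negative on \<open>K\<close> if the
  conclusion fails.\<close>

lemma ex_vertex_in_diametral_disk:
  fixes x y c :: "'a :: real_inner"
  assumes K: "K \<subseteq> sphere c r" and z: "z \<in> convex hull K" "z \<in> closed_segment x y"
    and out: "x \<notin> ball c r" "y \<notin> ball c r"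
  shows "\<exists>v\<in>K. (x - v) \<bullet> (y - v) \<le> 0"
proof (rule ccontr)
  assume neg: "\<not> (\<exists>v\<in>K. (x - v) \<bullet> (y - v) \<le> 0)"
  have "K \<noteq> {}" using z(1) by auto
  then have r: "r \<ge> 0" using K by (auto simp: sphere_def intro: order_trans[OF zero_le_dist])
  define n where "n = x + y - 2 *\<^sub>R c"
  define b where "b = r\<^sup>2 + x \<bullet> y - c \<bullet> c"
  have "n \<bullet> v < b" if "v \<in> K" for v
  proof -
    have "(v - c) \<bullet> (v - c) = r\<^sup>2"
      using K that by (auto simp: dist_norm norm_minus_commute power2_norm_eq_inner[symmetric])
    moreover have "(x - v) \<bullet> (y - v) > 0" using neg that by (auto simp: not_le)
    ultimately show ?thesis
      by (simp add: n_def b_def inner_diff inner_add inner_commute)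
  qed
  then have "convex hull K \<subseteq> {u. n \<bullet> u < b}"
    by (intro hull_minimal convex_halfspace_lt) auto
  moreover have "closed_segment x y \<subseteq> {u. n \<bullet> u \<ge> b}"
    using out unfolding power_nonneg_iff[OF r]
    by (intro closed_segment_subset convex_halfspace_ge)
       (auto simp: n_def b_def inner_diff inner_add inner_commute)
  ultimately show False using z by force
qed

section \<open>Orientation and circumcenters in the plane\<close>

text \<open>A quarter turn, so that \<open>rot u \<bullet> w\<close> is the determinant of
  \<open>u\<close> and \<open>w\<close>: an orientation test that vanishes for parallel vectors and
  whose sign tells the side of a line.\<close>

definition rot :: "point \<Rightarrow> point" where
  "rot u = vector [- (u $ 2), u $ 1]"

lemma DIM_point: "DIM(point) = 2"
  by simp

lemma inner_point: "(u::point) \<bullet> w = u $ 1 * w $ 1 + u $ 2 * w $ 2"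
  by (simp add: inner_vec_def sum_2)

lemma rot_decomposition: "(u \<bullet> u) *\<^sub>R v = (v \<bullet> u) *\<^sub>R u + (v \<bullet> rot u) *\<^sub>R rot u"
  by (simp add: vec_eq_iff forall_2 inner_point rot_def algebra_simps)

lemma rot_inner_self [simp]: "rot u \<bullet> u = 0" "u \<bullet> rot u = 0"
  by (simp_all add: inner_point rot_def)

lemma collinear_iff_rot: "collinear {a, b, c} \<longleftrightarrow> rot (b - a) \<bullet> (c - a) = 0"
proof -
  have "collinear {a, b, c} \<longleftrightarrow> collinear {0, b - a, c - a}"
    using collinear_3[of b a c] by (simp add: insert_commute)
  also have "\<dots> \<longleftrightarrow> rot (b - a) \<bullet> (c - a) = 0"
  proof
    assume "collinear {0, b - a, c - a}"
    then show "rot (b - a) \<bullet> (c - a) = 0"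
      unfolding collinear_lemma
    proof (elim disjE exE)
      assume "b - a = 0"
      then show ?thesis by (simp add: rot_def inner_point)
    qed simp_all
  next
    assume *: "rot (b - a) \<bullet> (c - a) = 0"
    show "collinear {0, b - a, c - a}"
    proof (cases "b = a")
      case False
      then have nz: "(b - a) \<bullet> (b - a) \<noteq> 0" by simp
      have "((b - a) \<bullet> (b - a)) *\<^sub>R (c - a) = ((c - a) \<bullet> (b - a)) *\<^sub>R (b - a)"
        using rot_decomposition[of "b - a" "c - a"] * by (simp add: inner_commute)
      then have "c - a = (((c - a) \<bullet> (b - a)) / ((b - a) \<bullet> (b - a))) *\<^sub>R (b - a)"
        using nz by (simp add: eq_vector_fraction_iff)
      then show ?thesis unfolding collinear_lemma by blast
    qed simp
  qed
  finally show ?thesis .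
qed

lemma negligible_collinear:
  assumes "a \<noteq> (b :: point)"
  shows "negligible {c. collinear {a, b, c}}"
proof -
  have "rot (b - a) \<bullet> rot (b - a) = (b - a) \<bullet> (b - a)"
    by (simp add: inner_point rot_def algebra_simps)
  then have "rot (b - a) \<noteq> 0" using assms by auto
  then have "negligible {c. rot (b - a) \<bullet> c = rot (b - a) \<bullet> a}"
    by (intro negligible_hyperplane) simp
  then show ?thesis by (simp add: collinear_iff_rot inner_diff_right)
qed

lemma card_3_noncollinearE:
  assumes "card K = 3" "\<not> collinear (K :: point set)"
  obtains a b c where "K = {a, b, c}" "a \<noteq> b" "b \<noteq> c" "a \<noteq> c" "\<not> collinear {a, b, c}"
  using assms by (auto simp: card_3_iff)

text \<open>Cramer's rule for the linear equations that equate the distances to \<open>a\<close>,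
  \<open>b\<close> and \<open>c\<close>; the denominator is twice the determinant of two sides. A
  closed formula, rather than a choice, makes the centre a measurable function of the
  points.\<close>

definition circumcenter :: "point \<Rightarrow> point \<Rightarrow> point \<Rightarrow> point" where
  "circumcenter a b c = a + (1 / (2 * (rot (b - a) \<bullet> (c - a)))) *\<^sub>R
     (((c - a) \<bullet> (c - a)) *\<^sub>R rot (b - a) - ((b - a) \<bullet> (b - a)) *\<^sub>R rot (c - a))"

lemma rot_antisym: "rot w \<bullet> u = - (rot u \<bullet> w)"
  by (simp add: inner_point rot_def)

lemma circumcenter_equidistant:
  assumes "\<not> collinear {a, b, c}"
  shows "{a, b, c} \<subseteq> sphere (circumcenter a b c) (dist (circumcenter a b c) a)"
proof -
  define D where "D = rot (b - a) \<bullet> (c - a)"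
  define m where "m = circumcenter a b c"
  have D: "D \<noteq> 0" using assms by (simp add: D_def collinear_iff_rot)
  have ma: "m - a = (1 / (2 * D)) *\<^sub>R
     (((c - a) \<bullet> (c - a)) *\<^sub>R rot (b - a) - ((b - a) \<bullet> (b - a)) *\<^sub>R rot (c - a))"
    by (simp add: m_def circumcenter_def D_def)
  have "(m - a) \<bullet> (b - a) = (1 / (2 * D)) * (((b - a) \<bullet> (b - a)) * D)"
    unfolding ma by (simp add: inner_diff_left rot_antisym[of "c - a"] D_def)
  then have b: "(m - a) \<bullet> (b - a) = ((b - a) \<bullet> (b - a)) / 2" using D by simp
  have "(m - a) \<bullet> (c - a) = (1 / (2 * D)) * (((c - a) \<bullet> (c - a)) * D)"
    unfolding ma by (simp add: inner_diff_left D_def)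
  then have c: "(m - a) \<bullet> (c - a) = ((c - a) \<bullet> (c - a)) / 2" using D by simp
  have eq: "dist m p = dist m a" if "(m - a) \<bullet> (p - a) = ((p - a) \<bullet> (p - a)) / 2" for p
  proof -
    have "(m - p) \<bullet> (m - p) = (m - a) \<bullet> (m - a)"
      using that by (simp add: inner_diff inner_commute field_simps)
    then show ?thesis by (simp add: dist_norm norm_eq_sqrt_inner)
  qed
  show ?thesis using eq[OF b] eq[OF c] by (simp add: m_def)
qed

text \<open>Uniqueness behind the definite description: the difference of two centres is orthogonal
  to two independent sides and hence zero.\<close>

lemma circumdisk_eq_ball:
  assumes "card K = 3" "\<not> collinear K" "K \<subseteq> sphere c r"
  shows "circumdisk K = ball c r"
  unfolding circumdisk_def
proof (rule the_equality)
  show "\<exists>c' r'. K \<subseteq> sphere c' r' \<and> ball c r = ball c' r'" using assms(3) by blast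
next
  fix B assume "\<exists>c' r'. K \<subseteq> sphere c' r' \<and> B = ball c' r'"
  then obtain c' r' where *: "K \<subseteq> sphere c' r'" "B = ball c' r'" by blast
  obtain k1 k2 k3 where K: "K = {k1, k2, k3}" "\<not> collinear {k1, k2, k3}"
    using card_3_noncollinearE[OF assms(1,2)] by metis
  have sq: "(p - m) \<bullet> (p - m) = s\<^sup>2" if "K \<subseteq> sphere m s" "p \<in> K" for p m :: point and s
    using that by (auto simp: dist_norm norm_minus_commute power2_norm_eq_inner[symmetric])
  have perp: "(p - k1) \<bullet> (c' - c) = 0" if "p \<in> K" for p
    using sq[OF assms(3) that] sq[OF *(1) that] sq[OF assms(3), of k1] sq[OF *(1), of k1]
    by (simp add: K inner_diff inner_commute algebra_simps)
  have "(k2 - k1) \<bullet> (c' - c) = 0" "(k3 - k1) \<bullet> (c' - c) = 0" using perp by (auto simp: K)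
  moreover have "rot (k2 - k1) \<bullet> (k3 - k1) \<noteq> 0" using K(2) by (simp add: collinear_iff_rot)
  ultimately have "(rot (k2 - k1) \<bullet> (k3 - k1)) * (c' - c) $ 1 = 0"
    "(rot (k2 - k1) \<bullet> (k3 - k1)) * (c' - c) $ 2 = 0"
    by (simp_all add: inner_point rot_def) algebra+
  then have "c' = c"
    using \<open>rot (k2 - k1) \<bullet> (k3 - k1) \<noteq> 0\<close> by (simp add: vec_eq_iff forall_2)
  moreover have "r' = r"
    using *(1) assms(3) \<open>c' = c\<close> by (simp add: K)
  ultimately show "B = ball c r" using * by simp
qed

lemma ex_circumdisk:
  assumes "card K = 3" "\<not> collinear (K :: point set)"
  obtains c r where "K \<subseteq> sphere c r" "circumdisk K = ball c r"
proof -
  obtain a b c where K: "K = {a, b, c}" "\<not> collinear {a, b, c}"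
    using card_3_noncollinearE[OF assms] by metis
  have s: "K \<subseteq> sphere (circumcenter a b c) (dist (circumcenter a b c) a)"
    using circumcenter_equidistant[OF K(2)] K(1) by simp
  show ?thesis using that[OF s circumdisk_eq_ball[OF assms s]] .
qed

section \<open>Disjointness of triangles with empty circumdisks\<close>

text \<open>The radical axis separates: if the centres differ, the difference of the two powers is a
  nonconstant affine function, at most 0 on \<open>K\<close> and at least 0 on \<open>K'\<close>, so
  it has opposite strict signs on the two interiors.\<close>

lemma empty_circumdisks_interiors_meet:
  fixes c c' :: "'a :: euclidean_space"
  assumes K: "K \<subseteq> sphere c r" "K \<inter> ball c' r' = {}" and K': "K' \<subseteq> sphere c' r'" "K' \<inter> ball c r = {}"
    and z: "z \<in> interior (convex hull K)" "z \<in> interior (convex hull K')"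
  shows "c = c' \<and> r = r'"
proof -
  have ne: "K \<noteq> {}" "K' \<noteq> {}" using z by auto
  then have r: "r \<ge> 0" "r' \<ge> 0" using K K' by (auto intro: order_trans[OF zero_le_dist])
  have on: "(u - m) \<bullet> (u - m) = s\<^sup>2" if "L \<subseteq> sphere m s" "u \<in> L" for u m :: 'a and L s
    using that by (auto simp: dist_norm norm_minus_commute power2_norm_eq_inner[symmetric])
  have out: "(u - m) \<bullet> (u - m) \<ge> s\<^sup>2" if "L \<inter> ball m s = {}" "u \<in> L" "s \<ge> 0" for u m :: 'a and L s
    using that power_nonneg_iff[of s u m] by blast
  have "c = c'"
  proof (rule ccontr)
    assume "c \<noteq> c'"
    define n where "n = 2 *\<^sub>R (c' - c)"
    define b where "b = c' \<bullet> c' - r'\<^sup>2 - c \<bullet> c + r\<^sup>2"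
    have n: "n \<noteq> 0" using \<open>c \<noteq> c'\<close> by (simp add: n_def)
    have "n \<bullet> u \<le> b" if "u \<in> K" for u
      using on[OF K(1) that] out[OF K(2) that r(2)]
      by (simp add: n_def b_def inner_diff inner_commute)
    then have "convex hull K \<subseteq> {u. n \<bullet> u \<le> b}"
      by (intro hull_minimal convex_halfspace_le) auto
    then have "n \<bullet> z < b"
      using z(1) interior_mono interior_halfspace_le[OF n, of b] by blast
    have "n \<bullet> u \<ge> b" if "u \<in> K'" for u
      using on[OF K'(1) that] out[OF K'(2) that r(1)]
      by (simp add: n_def b_def inner_diff inner_commute)
    then have "convex hull K' \<subseteq> {u. n \<bullet> u \<ge> b}"
      by (intro hull_minimal convex_halfspace_ge) auto
    then have "n \<bullet> z > b"
      using z(2) interior_mono interior_halfspace_ge[OF n, of b] by blast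
    with \<open>n \<bullet> z < b\<close> show False by simp
  qed
  moreover have "r = r'"
  proof -
    obtain k k' where "k \<in> K" "k' \<in> K'" using ne by auto
    then show ?thesis using K K' \<open>c = c'\<close> by fastforce
  qed
  ultimately show ?thesis by simp
qed

text \<open>Overlapping triangles would share their circumcircle, which would then carry a fourth
  point. Disjointness suffices for counting, so the existence of a Delaunay triangulation of the
  input is never invoked.\<close>

lemma delaunay_triangles_interiors_disjoint:
  assumes "general_position P" "delaunay_triangle P K" "delaunay_triangle P K'" "K \<noteq> K'"
  shows "interior (convex hull K) \<inter> interior (convex hull K') = {}"
proof (rule ccontr)
  assume "interior (convex hull K) \<inter> interior (convex hull K') \<noteq> {}"
  then obtain z where z: "z \<in> interior (convex hull K)" "z \<in> interior (convex hull K')" by blast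
  have d: "K \<subseteq> P" "card K = 3" "\<not> collinear K" "circumdisk K \<inter> P = {}"
    "K' \<subseteq> P" "card K' = 3" "\<not> collinear K'" "circumdisk K' \<inter> P = {}"
    using assms by (auto simp: delaunay_triangle_def)
  obtain c r where K: "K \<subseteq> sphere c r" "circumdisk K = ball c r" using ex_circumdisk[OF d(2,3)] .
  obtain c' r' where K': "K' \<subseteq> sphere c' r'" "circumdisk K' = ball c' r'" using ex_circumdisk[OF d(6,7)] .
  have "c = c' \<and> r = r'"
    using d K K' by (intro empty_circumdisks_interiors_meet[OF K(1) _ K'(1) _ z]) auto
  then have sub: "K \<union> K' \<subseteq> sphere c r" using K K' by auto
  have fin: "finite K" "finite K'" using d by (auto intro: card_ge_0_finite)
  have "\<not> K' \<subseteq> K" using card_subset_eq[OF fin(1)] assms(4) d by auto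
  then obtain p where p: "p \<in> K'" "p \<notin> K" by blast
  then have "card (insert p K) = 4" using fin d by simp
  moreover have "insert p K \<subseteq> P" "insert p K \<subseteq> sphere c r" using p d sub by auto
  ultimately show False using assms(1) unfolding general_position_def by blast
qed

section \<open>Counting triangles with disjoint interiors\<close>

text \<open>Points strictly between \<open>z\<close> and an interior point are interior by
  convexity, so the nearer of the two given points on the ray lies in both interiors.\<close>

lemma interiors_meet_of_common_germ:
  fixes A B :: "'a :: euclidean_space set"
  assumes "convex A" "convex B" "z \<in> A" "z \<in> B" "s > 0" "t > 0"
    "z + s *\<^sub>R w \<in> interior A" "z + t *\<^sub>R w \<in> interior B"
  shows "interior A \<inter> interior B \<noteq> {}"
proof -
  have *: "z + m *\<^sub>R w \<in> interior S"
    if "convex S" "z \<in> S" "z + s *\<^sub>R w \<in> interior S" "0 < m" "m \<le> s" for S and m s :: real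
    using mem_interior_convex_shrink[OF that(1,3,2), of "m / s"] that by simp
  have "z + min s t *\<^sub>R w \<in> interior A" "z + min s t *\<^sub>R w \<in> interior B"
    using *[OF assms(1,3,7), of "min s t"] *[OF assms(2,4,8), of "min s t"] assms(5,6) by simp_all
  then show ?thesis by blast
qed

text \<open>Two members with the same point \<open>z\<close> and the same sign would overlap near
  \<open>z\<close>, so the pair identifies the member; the factor 2 counts the signs.\<close>

lemma card_le_of_germs:
  fixes w :: "'a :: euclidean_space"
  assumes disj: "\<And>K K'. K \<in> F \<Longrightarrow> K' \<in> F \<Longrightarrow> K \<noteq> K' \<Longrightarrow>
      interior (convex hull K) \<inter> interior (convex hull K') = {}"
    and germ: "\<And>K. K \<in> F \<Longrightarrow> \<exists>z\<in>Z. \<exists>\<sigma>\<in>{1, -1}. \<exists>s>0. z \<in> convex hull K \<and>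
      z + s *\<^sub>R \<sigma> *\<^sub>R w \<in> interior (convex hull K)"
    and "finite Z"
  shows "finite F \<and> card F \<le> 2 * card Z"
proof -
  obtain z where z: "\<And>K. K \<in> F \<Longrightarrow> z K \<in> Z \<and> (\<exists>\<sigma>\<in>{1, -1}. \<exists>s>0. z K \<in> convex hull K \<and>
      z K + s *\<^sub>R \<sigma> *\<^sub>R w \<in> interior (convex hull K))"
    using bchoice[of F "\<lambda>K z. z \<in> Z \<and> (\<exists>\<sigma>\<in>{1, -1}. \<exists>s>0. z \<in> convex hull K \<and>
      z + s *\<^sub>R \<sigma> *\<^sub>R w \<in> interior (convex hull K))"] germ by blast
  obtain \<sigma> where \<sigma>: "\<And>K. K \<in> F \<Longrightarrow> \<sigma> K \<in> {1, -1 :: real} \<and> (\<exists>s>0. z K \<in> convex hull K \<and>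
      z K + s *\<^sub>R \<sigma> K *\<^sub>R w \<in> interior (convex hull K))"
    using bchoice[of F "\<lambda>K \<sigma>. \<sigma> \<in> {1, -1 :: real} \<and> (\<exists>s>0. z K \<in> convex hull K \<and>
      z K + s *\<^sub>R \<sigma> *\<^sub>R w \<in> interior (convex hull K))"] z by blast
  have inj: "inj_on (\<lambda>K. (z K, \<sigma> K)) F"
  proof (rule inj_onI, rule ccontr)
    fix K K' assume *: "K \<in> F" "K' \<in> F" "(z K, \<sigma> K) = (z K', \<sigma> K')" "K \<noteq> K'"
    obtain s s' where "s > 0" "z K + s *\<^sub>R \<sigma> K *\<^sub>R w \<in> interior (convex hull K)"
      "s' > 0" "z K' + s' *\<^sub>R \<sigma> K' *\<^sub>R w \<in> interior (convex hull K')"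
      "z K \<in> convex hull K" "z K' \<in> convex hull K'"
      using \<sigma>[OF *(1)] \<sigma>[OF *(2)] by blast
    then have "interior (convex hull K) \<inter> interior (convex hull K') \<noteq> {}"
      using * by (intro interiors_meet_of_common_germ[of _ _ "z K" s s' "\<sigma> K *\<^sub>R w"]) auto
    then show False using disj * by blast
  qed
  have sub: "(\<lambda>K. (z K, \<sigma> K)) ` F \<subseteq> Z \<times> {1, -1}" using z \<sigma> by auto
  show ?thesis
    using inj_on_finite[OF inj sub] card_inj_on_le[OF inj sub] assms(3)
    by (simp add: card_cartesian_product mult.commute)
qed

lemma ex_injective_direction:
  fixes P :: "'a :: euclidean_space set"
  assumes "finite P"
  obtains d where "inj_on ((\<bullet>) d) P"
proof -
  define B where "B = (\<Union>(p, q)\<in>{(p, q). p \<in> P \<and> q \<in> P \<and> p \<noteq> q}. {d. (p - q) \<bullet> d = 0})"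
  have "finite {(p, q). p \<in> P \<and> q \<in> P \<and> p \<noteq> q}"
    using assms by (auto intro: finite_subset[of _ "P \<times> P"])
  then have "negligible B"
    unfolding B_def by (intro negligible_Union) (auto intro!: negligible_hyperplane)
  then have "B \<noteq> UNIV" using non_negligible_UNIV by metis
  then obtain d where "d \<notin> B" by blast
  then have "inj_on ((\<bullet>) d) P"
    by (auto simp: B_def inj_on_def inner_commute inner_diff)
  then show ?thesis by (rule that)
qed

lemma middle_vertex_germ:
  assumes nc: "\<not> collinear {a, b, c}" and less: "d \<bullet> a < d \<bullet> b" "d \<bullet> b < d \<bullet> c"
  shows "\<exists>\<sigma>\<in>{1, -1}. \<exists>s>0. b + s *\<^sub>R \<sigma> *\<^sub>R rot d \<in> interior (convex hull {a, b, c})"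
proof -
  \<comment> \<open>\<open>l\<close> places the point \<open>y\<close> of the side
    \<open>[a, c]\<close> at the height of \<open>b\<close>, so that \<open>y - b\<close> is a
    multiple of \<open>rot d\<close>. The midpoint of \<open>b\<close> and \<open>y\<close> then has
    positive barycentric coordinates.\<close>
  define l where "l = (d \<bullet> b - d \<bullet> a) / (d \<bullet> c - d \<bullet> a)"
  have l: "0 < l" "l < 1" using less by (auto simp: l_def)
  define y where "y = (1 - l) *\<^sub>R a + l *\<^sub>R c"
  have "l * (d \<bullet> c - d \<bullet> a) = d \<bullet> b - d \<bullet> a" using less by (simp add: l_def)
  then have dy: "(y - b) \<bullet> d = 0"
    by (simp add: y_def inner_add inner_diff inner_commute algebra_simps)
  have d: "d \<bullet> d > 0" using less by auto
  define \<alpha> where "\<alpha> = ((y - b) \<bullet> rot d) / (d \<bullet> d)"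
  have "(d \<bullet> d) *\<^sub>R (y - b) = ((y - b) \<bullet> rot d) *\<^sub>R rot d"
    using rot_decomposition[of d "y - b"] dy by simp
  then have y: "y - b = \<alpha> *\<^sub>R rot d"
    using d by (simp add: \<alpha>_def eq_vector_fraction_iff)
  have "\<alpha> \<noteq> 0"
  proof
    assume "\<alpha> = 0"
    then have "b \<in> closed_segment a c" using y l by (auto simp: y_def in_segment intro!: exI[of _ l])
    then have "collinear {a, b, c}"
      by (meson between_mem_segment between_imp_collinear)
    then show False using nc by simp
  qed
  have "b + (\<bar>\<alpha>\<bar> / 2) *\<^sub>R sgn \<alpha> *\<^sub>R rot d = b + (1/2) *\<^sub>R (y - b)"
    using \<open>\<alpha> \<noteq> 0\<close> by (cases "\<alpha> > 0") (auto simp: y)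
  also have "\<dots> = ((1 - l) / 2) *\<^sub>R a + (1/2) *\<^sub>R b + (l / 2) *\<^sub>R c"
    by (simp add: y_def vec_eq_iff forall_2 field_simps)
  also have "\<dots> \<in> interior (convex hull {a, b, c})"
    unfolding interior_convex_hull_3_minimal[OF nc DIM_point]
    using l by (intro CollectI exI[of _ "(1 - l) / 2"] exI[of _ "1/2"] exI[of _ "l / 2"]) (auto simp: field_simps)
  finally show ?thesis
    using \<open>\<alpha> \<noteq> 0\<close> by (intro bexI[of _ "sgn \<alpha>"] exI[of _ "\<bar>\<alpha>\<bar> / 2"]) (auto simp: sgn_if)
qed

text \<open>Charge each triangle to its middle vertex in a generic direction: on one of the two sides of
  this vertex the triangle contains a germ of the transversal line, so no vertex is charged more
  than twice.\<close>

lemma card_triangles_le: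
  fixes P :: "point set"
  assumes "finite P"
    and tri: "\<And>K. K \<in> F \<Longrightarrow> K \<subseteq> P \<and> card K = 3 \<and> \<not> collinear K"
    and disj: "\<And>K K'. K \<in> F \<Longrightarrow> K' \<in> F \<Longrightarrow> K \<noteq> K' \<Longrightarrow>
      interior (convex hull K) \<inter> interior (convex hull K') = {}"
  shows "card F \<le> 2 * card P"
proof -
  obtain d :: point where d: "inj_on ((\<bullet>) d) P" using ex_injective_direction[OF assms(1)] .
  have "finite F \<and> card F \<le> 2 * card P"
  proof (rule card_le_of_germs[OF disj _ assms(1)])
    fix K assume "K \<in> F"
    then have K: "K \<subseteq> P" "card K = 3" "\<not> collinear K" using tri by auto
    have main: "\<exists>z\<in>P. \<exists>\<sigma>\<in>{1, -1}. \<exists>s>0. z \<in> convex hull K \<and>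
        z + s *\<^sub>R \<sigma> *\<^sub>R rot d \<in> interior (convex hull K)"
      if "K = {a, b, c}" "d \<bullet> a < d \<bullet> b" "d \<bullet> b < d \<bullet> c" for a b c
      using middle_vertex_germ[of a b c d] that K by (intro bexI[of _ b]) (auto simp: hull_inc)
    obtain a b c where abc: "K = {a, b, c}" "a \<noteq> b" "b \<noteq> c" "a \<noteq> c"
      using card_3_noncollinearE[OF K(2,3)] by metis
    have "d \<bullet> a \<noteq> d \<bullet> b" "d \<bullet> b \<noteq> d \<bullet> c" "d \<bullet> a \<noteq> d \<bullet> c"
      using d abc K(1) by (auto simp: inj_on_def)
    moreover have "K = {a, c, b}" "K = {b, a, c}" "K = {b, c, a}" "K = {c, a, b}" "K = {c, b, a}"
      using abc(1) by auto
    ultimately show "\<exists>z\<in>P. \<exists>\<sigma>\<in>{1, -1}. \<exists>s>0. z \<in> convex hull K \<and>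
        z + s *\<^sub>R \<sigma> *\<^sub>R rot d \<in> interior (convex hull K)"
      using main[of a b c, OF abc(1)] main[of a c b] main[of b a c] main[of b c a] main[of c a b]
        main[of c b a] unfolding linorder_neq_iff by satx
  qed
  then show ?thesis by simp
qed

lemma edge_germ:
  assumes nc: "\<not> collinear {a, b, c}"
  shows "\<exists>\<sigma>\<in>{1, -1}. \<exists>s>0. midpoint a b + s *\<^sub>R \<sigma> *\<^sub>R rot (b - a) \<in> interior (convex hull {a, b, c})"
proof -
  define u where "u = b - a"
  have "a \<noteq> b" using nc by auto
  then have u: "u \<bullet> u > 0" by (simp add: u_def)
  define \<alpha> where "\<alpha> = ((c - midpoint a b) \<bullet> rot u) / (u \<bullet> u)"
  define \<beta> where "\<beta> = ((c - midpoint a b) \<bullet> u) / (u \<bullet> u)"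
  have "(u \<bullet> u) *\<^sub>R (c - midpoint a b) = (u \<bullet> u) *\<^sub>R (\<beta> *\<^sub>R u + \<alpha> *\<^sub>R rot u)"
    using rot_decomposition[of u "c - midpoint a b"] u by (simp add: \<alpha>_def \<beta>_def scaleR_add_right)
  then have c: "c - midpoint a b = \<beta> *\<^sub>R u + \<alpha> *\<^sub>R rot u"
    using u by (simp only: scaleR_cancel_left) auto
  have "rot u \<bullet> (c - a) = (c - midpoint a b) \<bullet> rot u + (1/2) * (u \<bullet> rot u)"
    by (simp add: midpoint_def u_def inner_point algebra_simps add_divide_distrib)
  then have "\<alpha> \<noteq> 0"
    using nc u by (simp add: \<alpha>_def collinear_iff_rot u_def)
  \<comment> \<open>Moving orthogonally to the edge and not straight towards \<open>c\<close> shifts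
    the coefficients of \<open>a\<close> and \<open>b\<close> by \<open>t * \<beta>\<close>. With
    \<open>t \<le> 1/2\<close> both start from at least 1/4, and \<open>t\<close> is small enough
    for the shift to stay below that.\<close>
  define t where "t = 1 / (2 + 4 * \<bar>\<beta>\<bar>)"
  have t: "0 < t" "t \<le> 1/2" "t * \<bar>\<beta>\<bar> < 1/4"
    by (auto simp: t_def field_simps)
  have tb: "\<bar>t * \<beta>\<bar> < 1/4" using t by (simp add: abs_mult)
  have "midpoint a b + (t * \<bar>\<alpha>\<bar>) *\<^sub>R sgn \<alpha> *\<^sub>R rot u = midpoint a b + t *\<^sub>R (\<alpha> *\<^sub>R rot u)"
    using \<open>\<alpha> \<noteq> 0\<close> by (cases "\<alpha> > 0") auto
  also have "\<alpha> *\<^sub>R rot u = c - midpoint a b - \<beta> *\<^sub>R u" using c by simp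
  also have "midpoint a b + t *\<^sub>R \<dots>
      = ((1 - t) / 2 + t * \<beta>) *\<^sub>R a + ((1 - t) / 2 - t * \<beta>) *\<^sub>R b + t *\<^sub>R c"
    by (simp add: midpoint_def u_def vec_eq_iff forall_2 field_simps)
  also have "\<dots> \<in> interior (convex hull {a, b, c})"
    unfolding interior_convex_hull_3_minimal[OF nc DIM_point]
    using t tb by (intro CollectI exI[of _ "(1 - t) / 2 + t * \<beta>"] exI[of _ "(1 - t) / 2 - t * \<beta>"] exI[of _ t])
      (auto simp: field_simps abs_less_iff)
  finally show ?thesis
    using \<open>\<alpha> \<noteq> 0\<close> t by (intro bexI[of _ "sgn \<alpha>"] exI[of _ "t * \<bar>\<alpha>\<bar>"]) (auto simp: sgn_if u_def)
qed

lemma card_triangles_at_edge_le: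
  fixes a b :: point
  assumes tri: "\<And>K. K \<in> F \<Longrightarrow> a \<in> K \<and> b \<in> K \<and> card K = 3 \<and> \<not> collinear K" and "a \<noteq> b"
    and disj: "\<And>K K'. K \<in> F \<Longrightarrow> K' \<in> F \<Longrightarrow> K \<noteq> K' \<Longrightarrow>
      interior (convex hull K) \<inter> interior (convex hull K') = {}"
  shows "finite F \<and> card F \<le> 2"
proof -
  have "finite F \<and> card F \<le> 2 * card {midpoint a b}"
  proof (rule card_le_of_germs[OF disj _ finite.insertI[OF finite.emptyI]])
    fix K assume "K \<in> F"
    then have K: "a \<in> K" "b \<in> K" "card K = 3" "\<not> collinear K" using tri by auto
    then have "card (K - {a, b}) = 1" using assms(2) by (simp add: card_Diff_subset)
    then obtain c where "K - {a, b} = {c}" by (auto simp: card_1_singleton_iff)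
    then have c: "K = {a, b, c}" using K by blast
    then have c: "K = {a, b, c}" "\<not> collinear {a, b, c}" using K(4) by auto
    have "midpoint a b \<in> convex hull K"
      using K midpoint_in_closed_segment[of a b] by (meson convex_contains_segment convex_convex_hull hull_inc subsetD)
    then show "\<exists>z\<in>{midpoint a b}. \<exists>\<sigma>\<in>{1, -1}. \<exists>s>0. z \<in> convex hull K \<and>
        z + s *\<^sub>R \<sigma> *\<^sub>R rot (b - a) \<in> interior (convex hull K)"
      using edge_germ[OF c(2)] c(1) by auto
  qed
  then show ?thesis by simp
qed

section \<open>Delaunay edges from empty diametral disks\<close>

text \<open>The circles through \<open>x\<close> and \<open>y\<close> form a pencil:
  \<open>g u - s * \<delta> u\<close> is the power of \<open>u\<close> for the circle with parameter
  \<open>s\<close>, and \<open>s = 0\<close> gives the diametral circle. When \<open>s\<close> moves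
  towards a side that contains points, the first circle to reach one has an empty disk.\<close>

lemma ex_delaunay_triangle_of_empty_diametral_disk:
  fixes P :: "point set"
  assumes "finite P" "x \<in> P" "y \<in> P" "x \<noteq> y"
    and nc: "\<And>z. z \<in> P \<Longrightarrow> z \<noteq> x \<Longrightarrow> z \<noteq> y \<Longrightarrow> \<not> collinear {x, y, z}"
    and empty: "\<And>z. z \<in> P \<Longrightarrow> z \<noteq> x \<Longrightarrow> z \<noteq> y \<Longrightarrow> (x - z) \<bullet> (y - z) > 0"
    and other: "\<exists>z\<in>P. z \<noteq> x \<and> z \<noteq> y"
  shows "\<exists>K. delaunay_triangle P K \<and> x \<in> K \<and> y \<in> K"
proof -
  define \<delta> where "\<delta> z = rot (y - x) \<bullet> (z - x)" for z
  define g where "g z = (x - z) \<bullet> (y - z)" for z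
  have \<delta>: "\<delta> z \<noteq> 0" if "z \<in> P" "z \<noteq> x" "z \<noteq> y" for z
    using nc[OF that] by (simp add: \<delta>_def collinear_iff_rot)
  \<comment> \<open>The sign \<open>\<sigma>\<close> selects a side of the line through
    \<open>x\<close> and \<open>y\<close> that contains a point of \<open>P\<close>. On the other
    side the powers do not decrease, so only the points in \<open>Q\<close> compete for being
    reached first.\<close>
  obtain \<sigma> :: real and z1 where \<sigma>: "z1 \<in> P" "z1 \<noteq> x" "z1 \<noteq> y" "\<sigma> * \<delta> z1 > 0"
    using other \<delta> by (metis mult_minus_left mult_1 neg_0_less_iff_less linorder_neqE_linordered_idom)
  define Q where "Q = {z \<in> P - {x, y}. \<sigma> * \<delta> z > 0}"
  have Q: "finite Q" "Q \<noteq> {}" using assms(1) \<sigma> by (auto simp: Q_def)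
  obtain z0 where z0: "z0 \<in> Q" "\<And>z. z \<in> Q \<Longrightarrow> g z0 / (\<sigma> * \<delta> z0) \<le> g z / (\<sigma> * \<delta> z)"
    using ex_min_if_finite[of "(\<lambda>z. g z / (\<sigma> * \<delta> z)) ` Q"] Q by (fastforce simp: not_less)
  have z0': "z0 \<in> P" "z0 \<noteq> x" "z0 \<noteq> y" "\<sigma> * \<delta> z0 > 0" using z0(1) by (auto simp: Q_def)
  define s where "s = g z0 / \<delta> z0"
  have s\<delta>: "s * \<delta> z = (g z0 / (\<sigma> * \<delta> z0)) * (\<sigma> * \<delta> z)" for z
    using z0'(4) by (auto simp: s_def field_simps)
  have g_ge: "g z \<ge> s * \<delta> z" if "z \<in> P" "z \<noteq> x" "z \<noteq> y" for z
  proof (cases "\<sigma> * \<delta> z > 0")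
    case True
    then have "z \<in> Q" using that by (auto simp: Q_def)
    then show ?thesis using z0(2)[of z] True unfolding s\<delta> by (simp add: pos_le_divide_eq)
  next
    case False
    have "g z0 / (\<sigma> * \<delta> z0) \<ge> 0" using empty[OF z0'(1-3)] z0'(4) by (auto simp: g_def)
    moreover have "\<sigma> * \<delta> z \<le> 0" using False by linarith
    ultimately have "s * \<delta> z \<le> 0"
      unfolding s\<delta> by (rule mult_nonneg_nonpos)
    then show ?thesis using empty[OF that] by (simp add: g_def)
  qed
  define c where "c = (1/2) *\<^sub>R (x + y) + (s / 2) *\<^sub>R rot (y - x)"
  have power: "(u - c) \<bullet> (u - c) = (dist c x)\<^sup>2 + (g u - s * \<delta> u)" for u
  proof -
    have "2 * ((u - x) \<bullet> c) = (u - x) \<bullet> (x + y) + s * \<delta> u"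
      by (simp add: c_def \<delta>_def inner_add inner_diff inner_commute algebra_simps)
    then show ?thesis
      by (simp add: g_def dist_norm power2_norm_eq_inner inner_diff inner_add inner_commute algebra_simps)
  qed
  have on: "dist c u = dist c x" if "g u = s * \<delta> u" for u
  proof -
    have "(dist c u)\<^sup>2 = (dist c x)\<^sup>2"
      using power[of u] that by (simp add: dist_norm power2_norm_eq_inner inner_diff inner_commute)
    then show ?thesis by (simp add: power2_eq_iff_nonneg)
  qed
  define K where "K = {x, y, z0}"
  have K: "K \<subseteq> P" "card K = 3" "\<not> collinear K"
    using assms z0' nc[OF z0'(1-3)] by (auto simp: K_def)
  have "dist c y = dist c x" "dist c z0 = dist c x"
    using z0' by (auto intro!: on simp: g_def \<delta>_def s_def)
  then have sph: "K \<subseteq> sphere c (dist c x)" by (auto simp: K_def)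
  have "circumdisk K = ball c (dist c x)"
    by (rule circumdisk_eq_ball[OF K(2,3) sph])
  moreover have "z \<notin> ball c (dist c x)" if "z \<in> P" for z
    using g_ge[OF that] power[of z] power_nonneg_iff[of "dist c x" z c] \<open>dist c y = dist c x\<close>
    by (cases "z = x \<or> z = y") auto
  ultimately have "delaunay_triangle P K"
    using K by (auto simp: delaunay_triangle_def)
  then show ?thesis by (auto simp: K_def)
qed

section \<open>Triangulations\<close>

lemma affine_independent_of_noncollinear:
  assumes "card K = 3" "\<not> collinear (K :: point set)"
  shows "\<not> affine_dependent K"
proof -
  obtain a b c where "K = {a, b, c}" "a \<noteq> b" "b \<noteq> c" "a \<noteq> c" "\<not> collinear {a, b, c}"
    using card_3_noncollinearE[OF assms] .
  then show ?thesis using collinear_3_eq_affine_dependent by blast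
qed

lemma convex_hull_eq_imp_eq:
  fixes S S' :: "'a :: euclidean_space set"
  assumes "convex hull S = convex hull S'" "\<not> affine_dependent S" "\<not> affine_dependent S'"
  shows "S = S'"
  using extreme_point_of_convex_hull_affine_independent[OF assms(2)]
    extreme_point_of_convex_hull_affine_independent[OF assms(3)] assms(1) by auto

context
  fixes V T
  assumes dt: "delaunay_triangulation V T" and finV: "finite V"
begin

lemma triangleD:
  assumes "K \<in> T"
  shows "K \<subseteq> V" "card K = 3" "\<not> collinear K" "\<not> affine_dependent K" "finite K"
  using assms dt affine_independent_of_noncollinear
  by (auto simp: delaunay_triangulation_def delaunay_triangle_def intro: card_ge_0_finite)

lemma finite_triangles: "finite T"
  using triangleD(1) finV by (intro finite_subset[of T "Pow V"]) auto

lemma inter_face: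
  assumes "K \<in> T" "K' \<in> T"
  shows "(convex hull K \<inter> convex hull K') face_of convex hull K"
    "(convex hull K \<inter> convex hull K') face_of convex hull K'"
proof -
  have *: "(convex hull K \<inter> convex hull K') face_of convex hull K" if "K \<in> T" "K' \<in> T" for K K'
    using that dt by (auto simp: delaunay_triangulation_def triangulation_def)
  show "(convex hull K \<inter> convex hull K') face_of convex hull K"
    "(convex hull K \<inter> convex hull K') face_of convex hull K'"
    using *[OF assms] *[OF assms(2,1)] by (simp_all add: Int_commute)
qed

text \<open>Here \<open>V\<close> may have cocircular points, so circumdisks do not decide. Instead
  the common face is used: a face that meets the interior of a triangle is the whole
  triangle.\<close>

lemma triangles_interiors_disjoint:
  assumes "K \<in> T" "K' \<in> T" "K \<noteq> K'"
  shows "interior (convex hull K) \<inter> interior (convex hull K') = {}"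
proof (rule ccontr)
  assume "interior (convex hull K) \<inter> interior (convex hull K') \<noteq> {}"
  then obtain z where z: "z \<in> interior (convex hull K)" "z \<in> interior (convex hull K')" by blast
  then have "z \<in> convex hull K \<inter> convex hull K'" using interior_subset by blast
  then have "convex hull K \<inter> convex hull K' = convex hull K"
    "convex hull K \<inter> convex hull K' = convex hull K'"
    using face_of_disjoint_interior[OF inter_face(1)[OF assms(1,2)]]
      face_of_disjoint_interior[OF inter_face(2)[OF assms(1,2)]] z by blast+
  then show False
    using convex_hull_eq_imp_eq[of K K'] triangleD assms by auto
qed

lemma card_triangulation_le: "card T \<le> 2 * card V"
proof (rule card_triangles_le[OF finV])
  fix K assume "K \<in> T"
  then show "K \<subseteq> V \<and> card K = 3 \<and> \<not> collinear K" using triangleD(1-3)[of K] by simp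
qed (rule triangles_interiors_disjoint)

text \<open>The common face is the hull of a set of common vertices. A single vertex is excluded by
  \<open>z \<notin> V\<close>, three of them by \<open>K \<noteq> K'\<close>.\<close>

lemma triangles_share_edge:
  assumes "K \<in> T" "K' \<in> T" "z \<in> convex hull K" "z \<in> convex hull K'" "z \<notin> V" "K \<noteq> K'"
  shows "card (K \<inter> K') = 2"
proof -
  obtain c where c: "c \<subseteq> K" "convex hull K \<inter> convex hull K' = convex hull c"
    using inter_face(1)[OF assms(1,2)]
    unfolding face_of_convex_hull_affine_independent[OF triangleD(4)[OF assms(1)]] by blast
  obtain c' where c': "c' \<subseteq> K'" "convex hull K \<inter> convex hull K' = convex hull c'"
    using inter_face(2)[OF assms(1,2)]
    unfolding face_of_convex_hull_affine_independent[OF triangleD(4)[OF assms(2)]] by blast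
  have "\<not> affine_dependent c" "\<not> affine_dependent c'"
    using affine_independent_subset[OF triangleD(4)] assms(1,2) c(1) c'(1) by blast+
  then have "c = c'"
    using c(2) c'(2) convex_hull_eq_imp_eq by metis
  have z: "z \<in> convex hull c" using c(2) assms(3,4) by blast
  have "finite c" using c(1) triangleD(5)[OF assms(1)] by (rule finite_subset)
  have "card c \<noteq> 0" using z \<open>finite c\<close> by auto
  moreover have "card c \<noteq> 1"
    using z c(1) triangleD(1)[OF assms(1)] assms(5) by (auto simp: card_1_singleton_iff)
  moreover have "card c \<le> card (K \<inter> K')"
    using c(1) c'(1) \<open>c = c'\<close> triangleD(5)[OF assms(1)] by (intro card_mono) auto
  moreover have "card (K \<inter> K') \<noteq> 3"
  proof
    assume *: "card (K \<inter> K') = 3"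
    have "K \<inter> K' = K"
      by (rule card_subset_eq) (use * triangleD[OF assms(1)] in auto)
    moreover have "K \<inter> K' = K'"
      by (rule card_subset_eq) (use * triangleD[OF assms(2)] in auto)
    ultimately show False using assms(6) by simp
  qed
  moreover have "card (K \<inter> K') \<le> 3"
    using card_mono[of K "K \<inter> K'"] triangleD(2,5)[OF assms(1)] by auto
  ultimately show ?thesis by linarith
qed

text \<open>Three sides with at most two triangles each; the crude 6 counts \<open>K\<close> itself
  at every side.\<close>

lemma card_edge_neighbours_le:
  assumes "K \<in> T"
  shows "card {K'\<in>T. card (K \<inter> K') = 2} \<le> 6"
proof -
  let ?E = "{e. e \<subseteq> K \<and> card e = 2}"
  have E: "finite ?E" "card ?E = 3"
    using triangleD(2,5)[OF assms] n_subsets[of K 2] by (auto simp: choose_two)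
  have "{K'\<in>T. card (K \<inter> K') = 2} \<subseteq> (\<Union>e\<in>?E. {K'\<in>T. e \<subseteq> K'})"
  proof
    fix K' assume "K' \<in> {K'\<in>T. card (K \<inter> K') = 2}"
    then have "K \<inter> K' \<in> ?E" "K' \<in> T" by auto
    then show "K' \<in> (\<Union>e\<in>?E. {K'\<in>T. e \<subseteq> K'})" by blast
  qed
  then have "card {K'\<in>T. card (K \<inter> K') = 2} \<le> card (\<Union>e\<in>?E. {K'\<in>T. e \<subseteq> K'})"
    using E finite_triangles by (intro card_mono) auto
  also have "\<dots> \<le> (\<Sum>e\<in>?E. card {K'\<in>T. e \<subseteq> K'})"
    using E(1) by (rule card_UN_le)
  also have "\<dots> \<le> (\<Sum>e\<in>?E. 2)"
  proof (rule sum_mono)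
    fix e assume "e \<in> ?E"
    then obtain a b where e: "e = {a, b}" "a \<noteq> b" by (auto simp: card_2_iff)
    have "finite {K'\<in>T. e \<subseteq> K'} \<and> card {K'\<in>T. e \<subseteq> K'} \<le> 2"
    proof (rule card_triangles_at_edge_le[OF _ e(2)])
      fix L assume "L \<in> {K'\<in>T. e \<subseteq> K'}"
      then show "a \<in> L \<and> b \<in> L \<and> card L = 3 \<and> \<not> collinear L"
        using e(1) triangleD(2,3)[of L] by simp
    qed (use triangles_interiors_disjoint in simp)
    then show "card {K'\<in>T. e \<subseteq> K'} \<le> 2" by simp
  qed
  finally show ?thesis using E by simp
qed

section \<open>Triangles along a segment\<close>

lemma triangle_interior_near:
  assumes "K \<in> T" "x \<in> convex hull K" "\<delta> > 0"
  shows "open (interior (convex hull K) \<inter> ball x \<delta>)" "interior (convex hull K) \<inter> ball x \<delta> \<noteq> {}"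
proof -
  show "open (interior (convex hull K) \<inter> ball x \<delta>)" by auto
  obtain a b c where K: "K = {a, b, c}" "\<not> collinear {a, b, c}"
    using card_3_noncollinearE[OF triangleD(2,3)[OF assms(1)]] by metis
  have "interior (convex hull K) \<noteq> {}" using edge_germ[OF K(2)] K(1) by blast
  then have "closure (interior (convex hull K)) = closure (convex hull K)"
    by (intro convex_closure_interior) auto
  then have "x \<in> closure (interior (convex hull K))" using assms(2) closure_subset by blast
  then obtain z where "z \<in> interior (convex hull K)" "dist z x < \<delta>"
    using assms(3) closure_approachable[of x "interior (convex hull K)"] by blast
  then show "interior (convex hull K) \<inter> ball x \<delta> \<noteq> {}" by (auto simp: dist_commute)
qed

text \<open>Perturbing the endpoints makes the segment avoid all vertices, so that two triangles with a
  common point on it share an edge.\<close>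

lemma triangles_meeting_segment_connected:
  assumes K0: "K0 \<in> T" "x \<in> convex hull K0" and K1: "K1 \<in> T" "y \<in> convex hull K1"
  shows "(K0, K1) \<in> {(K, K'). K \<in> T \<and> K' \<in> T \<and> convex hull K \<inter> closed_segment x y \<noteq> {} \<and>
    convex hull K' \<inter> closed_segment x y \<noteq> {} \<and> card (K \<inter> K') = 2}\<^sup>*"
proof -
  define W where "W = {K\<in>T. convex hull K \<inter> closed_segment x y \<noteq> {}}"
  have "\<forall>K\<in>T - W. \<exists>d>0. \<forall>p\<in>convex hull K. \<forall>q\<in>closed_segment x y. d \<le> dist p q"
  proof
    fix K assume "K \<in> T - W"
    then have "convex hull K \<inter> closed_segment x y = {}" "finite K"
      using triangleD(5)[of K] unfolding W_def by blast+
    then show "\<exists>d>0. \<forall>p\<in>convex hull K. \<forall>q\<in>closed_segment x y. d \<le> dist p q"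
      using separate_compact_closed[OF finite_imp_compact_convex_hull closed_segment] by metis
  qed
  from bchoice[OF this]
  obtain d where "\<forall>K\<in>T - W. d K > 0 \<and> (\<forall>p\<in>convex hull K. \<forall>q\<in>closed_segment x y. d K \<le> dist p q)" ..
  then have d: "\<And>K. K \<in> T - W \<Longrightarrow> d K > 0"
    "\<And>K p q. K \<in> T - W \<Longrightarrow> p \<in> convex hull K \<Longrightarrow> q \<in> closed_segment x y \<Longrightarrow> d K \<le> dist p q"
    by blast+
  \<comment> \<open>A gap: triangles that miss the segment stay at least \<open>\<delta>\<close>
    away from it, so moving the endpoints by less than \<open>\<delta>\<close> creates no new
    intersections. The entry 1 keeps the minimum defined when no triangle misses the
    segment.\<close>
  define \<delta> where "\<delta> = Min (insert 1 (d ` (T - W)))"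
  have "finite (insert 1 (d ` (T - W)))" using finite_triangles by simp
  then have "\<delta> \<in> insert 1 (d ` (T - W))" unfolding \<delta>_def by (intro Min_in) simp_all
  then have "\<delta> > 0" using d(1) zero_less_one by blast
  have "\<delta> \<le> d K" if "K \<in> T - W" for K
    unfolding \<delta>_def using that \<open>finite (insert 1 (d ` (T - W)))\<close> by (intro Min_le) simp_all
  note \<delta> = \<open>\<delta> > 0\<close> this
  note U0 = triangle_interior_near[OF K0 \<delta>(1)] and U1 = triangle_interior_near[OF K1 \<delta>(1)]
  \<comment> \<open>A nonempty open set is infinite, hence not contained in \<open>V\<close>. Only
    for \<open>p\<close> outside \<open>V\<close> are the sets excluded for \<open>q\<close> below
    proper lines, and thus negligible.\<close>
  have "\<not> interior (convex hull K0) \<inter> ball x \<delta> \<subseteq> V"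
  proof
    assume "interior (convex hull K0) \<inter> ball x \<delta> \<subseteq> V"
    then have "finite (interior (convex hull K0) \<inter> ball x \<delta>)" using finV by (rule finite_subset)
    from finite_imp_not_open[OF this U0(1)] show False using U0(2) by simp
  qed
  then obtain p where "p \<in> interior (convex hull K0) \<inter> ball x \<delta>" "p \<notin> V" by blast
  then have p: "p \<in> interior (convex hull K0)" "dist x p < \<delta>" "p \<notin> V" by auto
  have neg: "negligible (\<Union>v\<in>V. {q. collinear {p, v, q}})"
    using finV p(3) by (intro negligible_Union) (auto intro!: negligible_collinear)
  have "\<not> interior (convex hull K1) \<inter> ball y \<delta> \<subseteq> (\<Union>v\<in>V. {q. collinear {p, v, q}})"
    using open_not_negligible[OF U1] negligible_subset[OF neg] by metis
  then obtain q where "q \<in> interior (convex hull K1) \<inter> ball y \<delta>"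
    "q \<notin> (\<Union>v\<in>V. {q. collinear {p, v, q}})"
    by blast
  then have q: "q \<in> interior (convex hull K1)" "dist y q < \<delta>"
    "\<And>v. v \<in> V \<Longrightarrow> \<not> collinear {p, v, q}" by auto
  have avoid: "v \<notin> closed_segment p q" if "v \<in> V" for v
    using q(3)[OF that] by (meson between_mem_segment between_imp_collinear)
  define W' where "W' = {K\<in>T. convex hull K \<inter> closed_segment p q \<noteq> {}}"
  have "K \<in> W" if K: "K \<in> W'" for K
  proof (rule ccontr)
    assume "K \<notin> W"
    obtain u where u: "0 \<le> u" "u \<le> 1" "(1 - u) *\<^sub>R p + u *\<^sub>R q \<in> convex hull K"
      using K by (auto simp: W'_def in_segment)
    have "dist ((1 - u) *\<^sub>R p + u *\<^sub>R q) ((1 - u) *\<^sub>R x + u *\<^sub>R y)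
        = norm ((1 - u) *\<^sub>R (p - x) + u *\<^sub>R (q - y))"
      by (simp add: dist_norm algebra_simps)
    also have "\<dots> \<le> (1 - u) * dist x p + u * dist y q"
      using u norm_triangle_ineq[of "(1 - u) *\<^sub>R (p - x)" "u *\<^sub>R (q - y)"]
      by (simp add: dist_norm norm_minus_commute)
    also have "\<dots> < \<delta>"
      using u p(2) q(2) by (intro convex_bound_lt) auto
    also have "\<delta> \<le> d K" using \<delta>(2) \<open>K \<notin> W\<close> K by (auto simp: W'_def)
    also have "d K \<le> dist ((1 - u) *\<^sub>R p + u *\<^sub>R q) ((1 - u) *\<^sub>R x + u *\<^sub>R y)"
      using d(2)[of K] u \<open>K \<notin> W\<close> K by (auto simp: W'_def in_segment)
    finally show False by simp
  qed
  then have W'W: "W' \<subseteq> W" by blast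
  define R where "R = {(K, K'). K \<in> W' \<and> K' \<in> W' \<and> card (K \<inter> K') = 2}"
  define A where "A = {K\<in>W'. (K0, K) \<in> R\<^sup>*}"
  have pq: "p \<in> convex hull K0" "q \<in> convex hull K1" using p q interior_subset by blast+
  have "K0 \<in> W'" "K1 \<in> W'" using K0 K1 pq by (auto simp: W'_def)
  have fin: "finite W'" using finite_triangles by (simp add: W'_def)
  \<comment> \<open>Connectedness of the segment: if \<open>K1\<close> were not reachable, the
    reachable and the other triangles would cover it by two closed sets that both meet it. A common
    point is no vertex, so a reachable triangle would share an edge with an unreachable one.\<close>
  have "K1 \<in> A"
  proof (rule ccontr)
    assume "K1 \<notin> A"
    let ?F1 = "\<Union>K\<in>A. convex hull K" and ?F2 = "\<Union>K\<in>W' - A. convex hull K"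
    have closed: "closed ?F1" "closed ?F2"
    proof -
      have c: "closed (convex hull K)" if "K \<in> W'" for K
        using that triangleD(5)[of K] by (simp add: W'_def compact_imp_closed finite_imp_compact_convex_hull)
      have "finite A" "finite (W' - A)" "A \<subseteq> W'" using fin by (auto simp: A_def)
      then show "closed ?F1" "closed ?F2" using c by (intro closed_UN; blast)+
    qed
    have sub: "convex hull K0 \<subseteq> convex hull V" "convex hull K1 \<subseteq> convex hull V"
      using triangleD(1) K0 K1 by (auto intro!: hull_mono)
    have "closed_segment p q \<subseteq> convex hull V"
      using pq sub by (intro closed_segment_subset) auto
    also have "\<dots> = (\<Union>K\<in>T. convex hull K)"
      using dt unfolding delaunay_triangulation_def by (elim conjE) (rule sym)
    finally have cover: "closed_segment p q \<subseteq> ?F1 \<union> ?F2"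
      unfolding W'_def by blast
    have "p \<in> ?F1 \<inter> closed_segment p q" using pq \<open>K0 \<in> W'\<close> by (auto simp: A_def)
    moreover have "q \<in> ?F2 \<inter> closed_segment p q" using pq \<open>K1 \<in> W'\<close> \<open>K1 \<notin> A\<close> by auto
    ultimately have "?F1 \<inter> ?F2 \<inter> closed_segment p q \<noteq> {}"
      using connected_closedD[OF connected_segment(1) _ cover closed] by blast
    then obtain K K' z where z: "z \<in> closed_segment p q" "K \<in> A" "z \<in> convex hull K"
      "K' \<in> W' - A" "z \<in> convex hull K'" by blast
    have "card (K \<inter> K') = 2"
      using z avoid by (intro triangles_share_edge[of _ _ z]) (auto simp: A_def W'_def)
    then have "(K, K') \<in> R" using z by (auto simp: R_def A_def)
    then have "K' \<in> A" using z by (auto simp: A_def intro: rtrancl_into_rtrancl)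
    then show False using z by auto
  qed
  moreover have "R \<subseteq> {(K, K'). K \<in> T \<and> K' \<in> T \<and> convex hull K \<inter> closed_segment x y \<noteq> {} \<and>
    convex hull K' \<inter> closed_segment x y \<noteq> {} \<and> card (K \<inter> K') = 2}"
    using W'W by (auto simp: R_def W_def)
  ultimately show ?thesis using rtrancl_mono by (auto simp: A_def)
qed

end

section \<open>Encoding by walks\<close>

lemma rtrancl_crossing:
  assumes "(a, b) \<in> R\<^sup>*" "a \<in> S" "b \<notin> S"
  obtains u v where "(u, v) \<in> R" "u \<in> S" "v \<notin> S"
  using assms by (induction rule: rtrancl_induct) blast+

lemma rtrancl_map:
  assumes "\<And>x y. (x, y) \<in> R \<Longrightarrow> (f x, f y) \<in> S" "(a, b) \<in> R\<^sup>*"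
  shows "(f a, f b) \<in> S\<^sup>*"
  using assms(2) by (induction rule: rtrancl_induct) (auto intro: rtrancl_into_rtrancl assms(1))

text \<open>Each new vertex \<open>v\<close> is attached by a detour \<open>u\<close>,
  \<open>v\<close>, \<open>u\<close> of two steps. Reflexivity allows waiting at the root, which
  gives all walks the same length and leaves only one length to count.\<close>

lemma ex_covering_walk:
  assumes "finite Z" "r \<in> Z" and refl: "adj r r" and sym: "\<And>u v. adj u v \<Longrightarrow> adj v u"
    and conn: "\<And>z. z \<in> Z \<Longrightarrow> (r, z) \<in> {(u, v). u \<in> Z \<and> v \<in> Z \<and> adj u v}\<^sup>*"
    and "card Z \<le> k"
  shows "\<exists>w. length w = Suc (2 * k) \<and> hd w = r \<and> successively adj w \<and> set w = Z"
proof -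
  have grow: "\<exists>w. length w + 2 * card Z = 2 * k + 1 + 2 * Suc m \<and> w \<noteq> [] \<and> hd w = r \<and>
      successively adj w \<and> set w \<subseteq> Z \<and> card (set w) = Suc m" if "Suc m \<le> card Z" for m
    using that
  proof (induction m)
    case 0
    \<comment> \<open>The initial wait is so long that, after \<open>card Z - 1\<close> detours of
      two steps, exactly \<open>2 * k + 1\<close> states have been listed.\<close>
    define L where "L = 2 * k + 3 - 2 * card Z"
    have L: "L > 0" "L + 2 * card Z = 2 * k + 3" using assms(6) by (auto simp: L_def)
    have "successively adj (replicate L r)"
    proof (induction L)
      case (Suc L)
      then show ?case using refl by (cases L) simp_all
    qed simp
    moreover have "set (replicate L r) = {r}" using L(1) by (simp add: set_replicate_conv_if)
    ultimately show ?case
      using L assms(2) by (intro exI[of _ "replicate L r"]) (auto simp: hd_replicate)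
  next
    case (Suc m)
    then obtain w where w: "length w + 2 * card Z = 2 * k + 1 + 2 * Suc m" "w \<noteq> []" "hd w = r"
      "successively adj w" "set w \<subseteq> Z" "card (set w) = Suc m" by auto
    obtain z where z: "z \<in> Z" "z \<notin> set w"
    proof -
      have "set w \<noteq> Z" using w(6) Suc.prems by auto
      then show ?thesis using w(5) that by blast
    qed
    have "r \<in> set w" using w(2,3) hd_in_set by blast
    then obtain u v where uv: "(u, v) \<in> {(u, v). u \<in> Z \<and> v \<in> Z \<and> adj u v}" "u \<in> set w" "v \<notin> set w"
      using rtrancl_crossing[OF conn[OF z(1)] _ z(2)] by blast
    obtain p q where pq: "w = p @ u # q" using uv(2) by (meson split_list)
    let ?w = "p @ u # v # u # q"
    have "successively adj ?w"
      using w(4) uv(1) sym[of u v] by (auto simp: pq successively_append_iff successively_Cons)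
    moreover have "hd ?w = r" using w(3) by (cases p) (simp_all add: pq)
    moreover have set: "set ?w = insert v (set w)" by (auto simp: pq)
    moreover have "card (set ?w) = Suc (Suc m)" unfolding set using uv(3) w(6) by simp
    moreover have "set ?w \<subseteq> Z" unfolding set using uv(1) w(5) by auto
    moreover have "length ?w + 2 * card Z = 2 * k + 1 + 2 * Suc (Suc m)" using w(1) by (simp add: pq)
    ultimately show ?case by (intro exI[of _ ?w]) simp
  qed
  have "card Z > 0" using assms(1,2) by (auto simp: card_gt_0_iff)
  then obtain m where m: "card Z = Suc m" using gr0_implies_Suc by blast
  obtain w where w: "length w + 2 * card Z = 2 * k + 1 + 2 * Suc m" "hd w = r"
      "successively adj w" "set w \<subseteq> Z" "card (set w) = Suc m"
    using grow[of m] m by auto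
  have "set w = Z" using w(4,5) m assms(1) by (intro card_subset_eq) auto
  then show ?thesis using w m by (intro exI[of _ w]) simp
qed

lemma card_walks_le:
  assumes "\<And>u. finite {v. adj u v}" "\<And>u. card {v. adj u v} \<le> d"
  shows "finite {w. length w = Suc l \<and> hd w = r \<and> successively adj w} \<and>
    card {w. length w = Suc l \<and> hd w = r \<and> successively adj w} \<le> d ^ l"
proof (induction l arbitrary: r)
  case 0
  have "{w. length w = Suc 0 \<and> hd w = r \<and> successively adj w} = {[r]}"
    by (auto simp: length_Suc_conv)
  then show ?case by simp
next
  case (Suc l)
  let ?W = "\<lambda>l r. {w. length w = Suc l \<and> hd w = r \<and> successively adj w}"
  have eq: "?W (Suc l) r = (#) r ` (\<Union>v\<in>{v. adj r v}. ?W l v)"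
  proof (intro equalityI subsetI)
    fix w assume w: "w \<in> ?W (Suc l) r"
    then obtain w' where "w = r # w'" "length w' = Suc l" by (cases w) auto
    then show "w \<in> (#) r ` (\<Union>v\<in>{v. adj r v}. ?W l v)"
      using w by (cases w') auto
  next
    fix w assume "w \<in> (#) r ` (\<Union>v\<in>{v. adj r v}. ?W l v)"
    then show "w \<in> ?W (Suc l) r" by (auto simp: successively_Cons)
  qed
  have "card (?W (Suc l) r) \<le> card (\<Union>v\<in>{v. adj r v}. ?W l v)"
    unfolding eq using assms(1) Suc by (intro card_image_le) auto
  also have "\<dots> \<le> (\<Sum>v\<in>{v. adj r v}. card (?W l v))"
    using assms(1) by (rule card_UN_le)
  also have "\<dots> \<le> (\<Sum>v\<in>{v. adj r v}. d ^ l)"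
    using Suc by (intro sum_mono) auto
  also have "\<dots> \<le> d * d ^ l"
    using assms(2)[of r] by simp
  finally have "card (?W (Suc l) r) \<le> d ^ Suc l" by simp
  moreover have "finite (?W (Suc l) r)" unfolding eq using assms(1) Suc by auto
  ultimately show ?case by simp
qed

text \<open>The decoder's state is the label of an input point together with a triangle; boundedly many
  moves are possible in each state.\<close>

definition move :: "nat set set \<Rightarrow> 'a set set \<Rightarrow> nat \<times> 'a set \<Rightarrow> nat \<times> 'a set \<Rightarrow> bool" where
  "move M T = (\<lambda>(i, K) (j, K'). (i = j \<and> K = K') \<or> (K = K' \<and> {i, j} \<in> M) \<or>
     (i = j \<and> K \<in> T \<and> K' \<in> T \<and> card (K \<inter> K') = 2))"

lemma move_refl: "move M T z z"
  by (auto simp: move_def split: prod.splits)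

lemma move_sym: "move M T u v \<Longrightarrow> move M T v u"
  by (auto simp: move_def insert_commute Int_commute split: prod.splits)

text \<open>The 7 is one for standing still and six for crossing a side; the \<open>\<Delta>\<close>
  moves along \<open>M\<close> keep the triangle.\<close>

lemma card_moves_le:
  assumes "finite T" "\<And>K. K \<in> T \<Longrightarrow> card {K'\<in>T. card (K \<inter> K') = 2} \<le> 6"
    and "\<And>i. finite {j. {i, j} \<in> M}" "\<And>i. card {j. {i, j} \<in> M} \<le> \<Delta>"
  shows "finite {v. move M T u v} \<and> card {v. move M T u v} \<le> 7 + \<Delta>"
proof -
  obtain i K where u: "u = (i, K)" by (cases u)
  let ?N = "if K \<in> T then {K'\<in>T. card (K \<inter> K') = 2} else {}"
  let ?S = "insert (i, K) ((\<lambda>j. (j, K)) ` {j. {i, j} \<in> M} \<union> Pair i ` ?N)"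
  have fin: "finite ?S" using assms by auto
  have sub: "{v. move M T u v} \<subseteq> ?S" by (auto simp: move_def u)
  have "card ?S \<le> Suc (card ((\<lambda>j. (j, K)) ` {j. {i, j} \<in> M} \<union> Pair i ` ?N))"
    by (rule card_insert_le_m1) auto
  also have "\<dots> \<le> Suc (card ((\<lambda>j. (j, K)) ` {j. {i, j} \<in> M}) + card (Pair i ` ?N))"
    using card_Un_le by auto
  also have "\<dots> \<le> Suc (card {j. {i, j} \<in> M} + card ?N)"
    using assms by (intro Suc_le_mono[THEN iffD2] add_mono card_image_le) auto
  also have "\<dots> \<le> Suc (\<Delta> + 6)"
    using assms(2)[of K] assms(4)[of i] by (intro Suc_le_mono[THEN iffD2] add_mono) auto
  finally show ?thesis
    using card_mono[OF fin sub] finite_subset[OF sub fin] by simp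
qed

definition location_of_marks :: "nat \<Rightarrow> (nat \<times> 'a set) set \<Rightarrow> nat \<Rightarrow> 'a set" where
  "location_of_marks n S = (\<lambda>i\<in>{1..n}. THE K. (i, K) \<in> S)"

lemma location_of_marks_graph:
  assumes "y \<in> extensional {1..n}"
  shows "location_of_marks n ((\<lambda>i. (i, y i)) ` {1..n}) = y"
proof
  fix i
  show "location_of_marks n ((\<lambda>i. (i, y i)) ` {1..n}) i = y i"
  proof (cases "i \<in> {1..n}")
    case True
    then have "(THE K. (i, K) \<in> (\<lambda>i. (i, y i)) ` {1..n}) = y i" by (intro the_equality) auto
    then show ?thesis using True by (simp add: location_of_marks_def)
  next
    case False
    then show ?thesis using assms by (auto simp: location_of_marks_def extensional_def)
  qed
qed

text \<open>A pair \<open>(i, K)\<close> among the marked states \<open>S\<close> says that \<open>K\<close> is the triangle of the \<open>i\<close>-th point.\<close>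

definition encodings ::
  "nat \<Rightarrow> 'a set set \<Rightarrow> nat \<Rightarrow> nat set set \<Rightarrow> nat \<Rightarrow> (nat \<Rightarrow> 'a set) set" where
  "encodings n T \<Delta> E k = {location_of_marks n S | S M K w.
     M \<subseteq> E \<and> (\<forall>i. finite {j. {i, j} \<in> M} \<and> card {j. {i, j} \<in> M} \<le> \<Delta>) \<and> K \<in> T \<and>
     length w = Suc (2 * k) \<and> hd w = (1, K) \<and> successively (move M T) w \<and> S \<subseteq> set w}"

text \<open>The factors count the subgraph \<open>M\<close> (one bit per edge of \<open>E\<close>),
  the initial triangle, the steps of the walk and the marked states (one bit per position). The
  initial label is always 1 and costs nothing.\<close>

lemma card_encodings_le:
  assumes T: "finite T" "\<And>K. K \<in> T \<Longrightarrow> card {K'\<in>T. card (K \<inter> K') = 2} \<le> 6" and E: "finite E"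
  shows "finite (encodings n T \<Delta> E k) \<and>
    card (encodings n T \<Delta> E k) \<le> 2 ^ card E * card T * (7 + \<Delta>) ^ (2 * k) * 2 ^ Suc (2 * k)"
proof -
  define \<M> where "\<M> = {M. M \<subseteq> E \<and> (\<forall>i. finite {j. {i, j} \<in> M} \<and> card {j. {i, j} \<in> M} \<le> \<Delta>)}"
  define walks where "walks M K = {w. length w = Suc (2 * k) \<and> hd w = (1, K) \<and> successively (move M T) w}" for M K
  have M: "finite \<M>" "card \<M> \<le> 2 ^ card E"
  proof -
    have sub: "\<M> \<subseteq> Pow E" by (auto simp: \<M>_def)
    then show "finite \<M>" by (rule finite_subset) (simp add: E)
    show "card \<M> \<le> 2 ^ card E" using card_mono[OF _ sub] E by (simp add: card_Pow)
  qed
  have W: "finite (walks M K) \<and> card (walks M K) \<le> (7 + \<Delta>) ^ (2 * k)" if "M \<in> \<M>" for M K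
    unfolding walks_def
  proof (rule card_walks_le)
    show "finite {v. move M T u v}" "card {v. move M T u v} \<le> 7 + \<Delta>" for u
      using card_moves_le[OF T, where M=M and \<Delta>=\<Delta> and u=u] that by (auto simp: \<M>_def)
  qed
  have marks: "finite (location_of_marks n ` Pow (set w)) \<and>
      card (location_of_marks n ` Pow (set w)) \<le> 2 ^ Suc (2 * k)" if "w \<in> walks M K" for w M K
  proof -
    have "card (location_of_marks n ` Pow (set w)) \<le> card (Pow (set w))"
      by (intro card_image_le) simp
    also have "\<dots> = 2 ^ card (set w)" by (simp add: card_Pow)
    also have "\<dots> \<le> 2 ^ length w" by (intro power_increasing card_length) simp
    also have "\<dots> = 2 ^ Suc (2 * k)" using that by (simp add: walks_def)
    finally show ?thesis by simp
  qed
  have eq: "encodings n T \<Delta> E k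
      = (\<Union>M\<in>\<M>. \<Union>K\<in>T. \<Union>w\<in>walks M K. location_of_marks n ` Pow (set w))"
    by (auto simp: encodings_def \<M>_def walks_def)
  have fin: "finite (encodings n T \<Delta> E k)"
    unfolding eq using M(1) T(1) W by (intro finite_UN_I) auto
  have "card (encodings n T \<Delta> E k)
      \<le> (\<Sum>M\<in>\<M>. \<Sum>K\<in>T. \<Sum>w\<in>walks M K. 2 ^ Suc (2 * k))"
    unfolding eq using M(1) T(1) W marks
    by (intro order_trans[OF card_UN_le] sum_mono) auto
  also have "\<dots> = (\<Sum>M\<in>\<M>. \<Sum>K\<in>T. card (walks M K) * 2 ^ Suc (2 * k))" by simp
  also have "\<dots> \<le> (\<Sum>M\<in>\<M>. \<Sum>K\<in>T. (7 + \<Delta>) ^ (2 * k) * 2 ^ Suc (2 * k))"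
    using W by (intro sum_mono mult_right_mono) auto
  also have "\<dots> = card \<M> * (card T * ((7 + \<Delta>) ^ (2 * k) * 2 ^ Suc (2 * k)))" by simp
  also have "\<dots> \<le> 2 ^ card E * (card T * ((7 + \<Delta>) ^ (2 * k) * 2 ^ Suc (2 * k)))"
    using M(2) by (rule mult_right_mono) simp
  finally show ?thesis using fin by (simp add: mult.assoc)
qed

section \<open>Size and edges of the Delaunay graph\<close>

text \<open>Counting triangles replaces Euler's formula: there are at most \<open>2 * n\<close> of
  them, and each accounts for at most all 8 subsets of its label set.\<close>

lemma card_delaunay_graph_le:
  assumes "inj_on x {1..n}" "general_position (x ` {1..n})"
  shows "finite (delaunay_graph n x)" "card (delaunay_graph n x) \<le> 16 * n"
proof -
  define F where "F = {K. delaunay_triangle (x ` {1..n}) K}"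
  define J where "J K = {i\<in>{1..n}. x i \<in> K}" for K
  have F: "F \<subseteq> Pow (x ` {1..n})" by (auto simp: F_def delaunay_triangle_def)
  then have finF: "finite F" by (rule finite_subset) simp
  have "card F \<le> 2 * card (x ` {1..n})"
  proof (rule card_triangles_le)
    fix K assume "K \<in> F"
    then show "K \<subseteq> x ` {1..n} \<and> card K = 3 \<and> \<not> collinear K"
      by (simp add: F_def delaunay_triangle_def)
  next
    fix K K' assume "K \<in> F" "K' \<in> F" "K \<noteq> K'"
    then show "interior (convex hull K) \<inter> interior (convex hull K') = {}"
      using delaunay_triangles_interiors_disjoint[OF assms(2)] by (simp add: F_def)
  qed simp
  then have cardF: "card F \<le> 2 * n" using card_image[OF assms(1)] by simp
  have cardJ: "card (Pow (J K)) = 8" if "K \<in> F" for K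
  proof -
    have "K \<subseteq> x ` {1..n}" "card K = 3" using that by (auto simp: F_def delaunay_triangle_def)
    then have "x ` J K = K" by (auto simp: J_def)
    moreover have "inj_on x (J K)" using assms(1) by (rule inj_on_subset) (auto simp: J_def)
    ultimately have "card (J K) = 3" using \<open>card K = 3\<close> card_image by metis
    then show ?thesis by (simp add: card_Pow J_def)
  qed
  have sub: "delaunay_graph n x \<subseteq> (\<Union>K\<in>F. Pow (J K))"
    by (auto simp: delaunay_graph_def F_def J_def)
  have fin: "finite (\<Union>K\<in>F. Pow (J K))" using finF by (auto simp: J_def)
  show "finite (delaunay_graph n x)" using sub fin by (rule finite_subset)
  have "card (delaunay_graph n x) \<le> card (\<Union>K\<in>F. Pow (J K))" using fin sub by (rule card_mono)
  also have "\<dots> \<le> (\<Sum>K\<in>F. card (Pow (J K)))" using finF by (rule card_UN_le)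
  also have "\<dots> = 8 * card F" using cardJ by simp
  finally show "card (delaunay_graph n x) \<le> 16 * n" using cardF by simp
qed

text \<open>The empty lune contains the diametral disk apart from the two endpoints. The extra edge
  \<open>{1, 2}\<close> is for \<open>n = 2\<close>, where there are no triangles and the graph,
  defined through triangles, has no edges.\<close>

lemma edge_in_delaunay_graph:
  assumes "inj_on x {1..n}" "general_position (x ` {1..n})"
    and ij: "i \<in> {1..n}" "j \<in> {1..n}" "i \<noteq> j"
    and lune: "\<And>k. k \<in> {1..n} \<Longrightarrow> k \<noteq> i \<Longrightarrow> k \<noteq> j \<Longrightarrow>
      \<not> (dist (x i) (x k) < dist (x i) (x j) \<and> dist (x j) (x k) < dist (x i) (x j))"
  shows "{i, j} \<in> insert {1, 2} (delaunay_graph n x)"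
proof (cases "\<exists>k\<in>{1..n}. k \<noteq> i \<and> k \<noteq> j")
  case True
  then obtain k where k: "k \<in> {1..n}" "k \<noteq> i" "k \<noteq> j" by blast
  have ne: "x a \<noteq> x b" if "a \<in> {1..n}" "b \<in> {1..n}" "a \<noteq> b" for a b
    using assms(1) that by (auto dest: inj_onD)
  have "\<exists>K. delaunay_triangle (x ` {1..n}) K \<and> x i \<in> K \<and> x j \<in> K"
  proof (rule ex_delaunay_triangle_of_empty_diametral_disk)
    fix z assume z: "z \<in> x ` {1..n}" "z \<noteq> x i" "z \<noteq> x j"
    then obtain l where l: "l \<in> {1..n}" "z = x l" by blast
    have "card {x i, x j, z} = 3" using z ne[OF ij] by simp
    moreover have "{x i, x j, z} \<subseteq> x ` {1..n}" using z ij by auto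
    ultimately show "\<not> collinear {x i, x j, z}"
      using assms(2) unfolding general_position_def by blast
    show "(x i - z) \<bullet> (x j - z) > 0"
    proof (rule ccontr)
      assume "\<not> (x i - z) \<bullet> (x j - z) > 0"
      then have "dist (x i) z < dist (x i) (x j)" "dist (x j) z < dist (x j) (x i)"
        using z dist_less_of_inner_nonpos[of "x i" z "x j"] dist_less_of_inner_nonpos[of "x j" z "x i"]
        by (auto simp: inner_commute)
      moreover have "l \<noteq> i" "l \<noteq> j" using z l by auto
      ultimately show False using lune[OF l(1)] l(2) by (simp add: dist_commute)
    qed
  next
    show "\<exists>z\<in>x ` {1..n}. z \<noteq> x i \<and> z \<noteq> x j"
      using k ne[OF k(1) ij(1)] ne[OF k(1) ij(2)] by blast
  qed (use ij ne[OF ij] in auto)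
  then show ?thesis using ij unfolding delaunay_graph_def by blast
next
  case False
  then have sub: "{1..n} \<subseteq> {i, j}" by blast
  have "1 \<in> {1..n}" using ij by auto
  moreover have "2 \<in> {1..n}" using ij by auto
  ultimately have "{1, 2} \<subseteq> {i, j}" using sub by blast
  then have "{i, j} = {1, 2}" by auto
  then show ?thesis by simp
qed

text \<open>The bound on \<open>k\<close> counts the states to be visited: the initial one, and for
  each crossing of an edge with a triangle one state per endpoint. Per triangle, each point in its
  circumdisk and each of its three vertices accounts for at most \<open>\<Delta>\<close> crossing
  edges.\<close>

lemma ex_encodings_constant:
  "\<exists>\<Delta>. \<forall>n V T x \<tau> k.
    finite V \<longrightarrow> delaunay_triangulation V T \<longrightarrow> n \<ge> 1 \<longrightarrow>
    inj_on x {1..n} \<longrightarrow> general_position (x ` {1..n}) \<longrightarrow>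
    \<tau> \<in> extensional {1..n} \<longrightarrow> (\<forall>i\<in>{1..n}. \<tau> i \<in> T \<and> x i \<in> convex hull (\<tau> i)) \<longrightarrow>
    1 + 2 * (\<Sum>K\<in>T. \<Delta> * card {i\<in>{1..n}. x i \<in> circumdisk K} + 3 * \<Delta>) \<le> k \<longrightarrow>
    \<tau> \<in> encodings n T \<Delta> (insert {1, 2} (delaunay_graph n x)) k"
proof -
  obtain \<Delta> where \<Delta>: "\<forall>(x :: nat \<Rightarrow> point) M v.
    M \<subseteq> {{i, j} | i j. x i \<noteq> x j} \<longrightarrow> no_close_edges (\<lambda>i j. dist (x i) (x j)) M \<longrightarrow>
    finite {e\<in>M. \<exists>i j. e = {i, j} \<and> (x i - v) \<bullet> (x j - v) \<le> 0} \<and>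
    card {e\<in>M. \<exists>i j. e = {i, j} \<and> (x i - v) \<bullet> (x j - v) \<le> 0} \<le> \<Delta>"
    using ex_ply_bound ..
  show ?thesis
  proof (intro exI[of _ \<Delta>] allI impI)
    fix n V T x \<tau> k
    assume finV: "finite V" and dt: "delaunay_triangulation V T" and n: "n \<ge> (1::nat)"
      and inj: "inj_on x {1..n}" and gp: "general_position (x ` {1..n})"
      and ext: "\<tau> \<in> extensional {1..n}" and \<tau>: "\<forall>i\<in>{1..n}. \<tau> i \<in> T \<and> x i \<in> convex hull (\<tau> i)"
      and k: "1 + 2 * (\<Sum>K\<in>T. \<Delta> * card {i\<in>{1..n}. x i \<in> circumdisk K} + 3 * \<Delta>) \<le> k"
    note tri = triangleD[OF dt finV] and finT = finite_triangles[OF dt finV]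
    obtain M where M: "M \<subseteq> {{i, j} | i j. i \<in> {1..n} \<and> j \<in> {1..n} \<and> i \<noteq> j}"
      and conn: "\<And>i j. i \<in> {1..n} \<Longrightarrow> j \<in> {1..n} \<Longrightarrow> (i, j) \<in> {(i, j). {i, j} \<in> M}\<^sup>*"
      and lune: "\<And>i j k. {i, j} \<in> M \<Longrightarrow> k \<in> {1..n} \<Longrightarrow> k \<noteq> i \<Longrightarrow> k \<noteq> j \<Longrightarrow>
        \<not> (dist (x i) (x k) < dist (x i) (x j) \<and> dist (x j) (x k) < dist (x i) (x j))"
      and two: "no_close_edges (\<lambda>i j. dist (x i) (x j)) M"
      by (rule ex_spanning_graph[of "{1..n}" "\<lambda>i j. dist (x i) (x j)", OF finite_atLeastAtMost dist_commute])
         (rule that)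
    have Mij: "i \<in> {1..n} \<and> j \<in> {1..n} \<and> i \<noteq> j" if "{i, j} \<in> M" for i j
      using M that by (auto simp: doubleton_eq_iff)
    have finM: "finite M"
      using M by (intro finite_subset[of M "Pow {1..n}"]) auto
    define ply where "ply v = {e\<in>M. \<exists>i j. e = {i, j} \<and> (x i - v) \<bullet> (x j - v) \<le> 0}" for v
    have "M \<subseteq> {{i, j} | i j. x i \<noteq> x j}"
    proof
      fix e assume "e \<in> M"
      then obtain i j where ij: "e = {i, j}" "i \<in> {1..n}" "j \<in> {1..n}" "i \<noteq> j" using M by blast
      then have "x i \<noteq> x j" using inj by (auto dest: inj_onD)
      then show "e \<in> {{i, j} | i j. x i \<noteq> x j}" using ij(1) by blast
    qed
    then have ply: "card (ply v) \<le> \<Delta>" for v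
      using \<Delta> two unfolding ply_def by simp
    have finply: "finite (ply v)" for v using finM by (simp add: ply_def)
    have ME: "M \<subseteq> insert {1, 2} (delaunay_graph n x)"
    proof
      fix e assume e: "e \<in> M"
      then obtain i j where ij: "e = {i, j}" "i \<in> {1..n}" "j \<in> {1..n}" "i \<noteq> j" using M by blast
      show "e \<in> insert {1, 2} (delaunay_graph n x)"
        unfolding ij(1) using e ij(1) by (intro edge_in_delaunay_graph[OF inj gp ij(2-4)] lune) auto
    qed
    \<comment> \<open>The closed diametral disk of an edge contains its endpoints, so the overlap at
      \<open>x i\<close> bounds the degree of \<open>i\<close>.\<close>
    have deg: "finite {j. {i, j} \<in> M} \<and> card {j. {i, j} \<in> M} \<le> \<Delta>" for i
    proof -
      have inj': "inj_on (\<lambda>j. {i, j}) {j. {i, j} \<in> M}"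
        by (auto simp: inj_on_def doubleton_eq_iff)
      have sub: "(\<lambda>j. {i, j}) ` {j. {i, j} \<in> M} \<subseteq> ply (x i)"
        by (fastforce simp: ply_def)
      show ?thesis
        using inj_on_finite[OF inj' sub finply] card_inj_on_le[OF inj' sub finply] ply[of "x i"] by simp
    qed
    define W where "W i j = {K\<in>T. convex hull K \<inter> closed_segment (x i) (x j) \<noteq> {}}" for i j
    have W_sym: "W i j = W j i" for i j by (simp add: W_def closed_segment_commute)
    \<comment> \<open>The initial state is inserted for the sake of \<open>n = 1\<close>, where
      \<open>M\<close> has no edges.\<close>
    define Z where "Z = insert (1, \<tau> 1) {(i, K). \<exists>j. {i, j} \<in> M \<and> K \<in> W i j}"
    define R where "R = {(u, v). u \<in> Z \<and> v \<in> Z \<and> move M T u v}"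
    have \<tau>W: "\<tau> i \<in> W i j" if "i \<in> {1..n}" for i j
      using \<tau> that by (auto simp: W_def)
    have reach1: "((i, \<tau> i), (i, K)) \<in> R\<^sup>*" if ij: "{i, j} \<in> M" and K: "K \<in> W i j" for i j K
    proof -
      obtain z where z: "z \<in> convex hull K" "z \<in> closed_segment (x i) (x j)" "K \<in> T"
        using K by (auto simp: W_def)
      have sub: "closed_segment (x i) z \<subseteq> closed_segment (x i) (x j)"
        using z(2) by (simp add: subset_closed_segment)
      have i: "\<tau> i \<in> T" "x i \<in> convex hull (\<tau> i)" using \<tau> Mij[OF ij] by auto
      show ?thesis
      proof (rule rtrancl_map[OF _ triangles_meeting_segment_connected[OF dt finV i z(3,1)]])
        fix L L'
        assume "(L, L') \<in> {(K, K'). K \<in> T \<and> K' \<in> T \<and> convex hull K \<inter> closed_segment (x i) z \<noteq> {} \<and>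
          convex hull K' \<inter> closed_segment (x i) z \<noteq> {} \<and> card (K \<inter> K') = 2}"
        then have L: "L \<in> T" "L' \<in> T" "card (L \<inter> L') = 2"
          "convex hull L \<inter> closed_segment (x i) z \<noteq> {}" "convex hull L' \<inter> closed_segment (x i) z \<noteq> {}"
          by blast+
        then have "L \<in> W i j" "L' \<in> W i j" using sub unfolding W_def by blast+
        then show "((i, L), (i, L')) \<in> R"
          using ij L by (auto simp: R_def Z_def move_def)
      qed
    qed
    \<comment> \<open>With the label \<open>i\<close> kept, \<open>T(V)\<close> is traversed along
      the edge up to the triangle of \<open>x j\<close>; only there the label changes to
      \<open>j\<close>.\<close>
    have reach2: "((i, \<tau> i), (j, \<tau> j)) \<in> R\<^sup>*" if ij: "{i, j} \<in> M" for i j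
    proof -
      have j: "\<tau> j \<in> W i j" "\<tau> j \<in> W j i"
        using \<tau>W[of j i] Mij[OF ij] W_sym[of i j] by simp_all
      have "{j, i} \<in> M" using ij by (simp add: insert_commute)
      then have "((i, \<tau> j), (j, \<tau> j)) \<in> R"
        using ij j by (auto simp: R_def Z_def move_def)
      then show ?thesis using reach1[OF ij j(1)] by (rule rtrancl_into_rtrancl[rotated])
    qed
    have reach3: "((1, \<tau> 1), (i, \<tau> i)) \<in> R\<^sup>*" if "i \<in> {1..n}" for i
    proof -
      have "((1, \<tau> 1), (i, \<tau> i)) \<in> (R\<^sup>*)\<^sup>*"
        by (rule rtrancl_map[of "{(i, j). {i, j} \<in> M}" "\<lambda>i. (i, \<tau> i)"])
           (use n that conn reach2 in auto)
      then show ?thesis by simp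
    qed
    have reach: "((1, \<tau> 1), z) \<in> R\<^sup>*" if z: "z \<in> Z" for z
    proof (cases "z = (1, \<tau> 1)")
      case False
      then obtain i j K where ijK: "z = (i, K)" "{i, j} \<in> M" "K \<in> W i j"
        using z by (auto simp: Z_def)
      then show ?thesis
        using reach3[of i] reach1[of i j K] Mij[of i j] by (auto intro: rtrancl_trans)
    qed simp
    have marks: "(\<lambda>i. (i, \<tau> i)) ` {1..n} \<subseteq> Z"
    proof
      fix z assume "z \<in> (\<lambda>i. (i, \<tau> i)) ` {1..n}"
      then obtain i where i: "i \<in> {1..n}" "z = (i, \<tau> i)" by blast
      show "z \<in> Z"
      proof (cases "i = 1")
        case False
        have "(i, 1) \<in> {(i, j). {i, j} \<in> M}\<^sup>*" using conn[OF i(1), of 1] n by simp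
        then obtain j where "{i, j} \<in> M" using False by (auto elim: converse_rtranclE)
        then show ?thesis using \<tau>W[OF i(1)] i(2) by (auto simp: Z_def)
      qed (use i in \<open>simp add: Z_def\<close>)
    qed
    define WW where "WW e = {K\<in>T. \<exists>i j. e = {i, j} \<and> K \<in> W i j}" for e
    have finZ: "finite (insert (1, \<tau> 1) (\<Union>e\<in>M. e \<times> WW e))"
      using finM finT M by (auto simp: WW_def intro: finite_subset[of _ "{1..n}"])
    have Zsub: "Z \<subseteq> insert (1, \<tau> 1) (\<Union>e\<in>M. e \<times> WW e)"
      by (auto simp: Z_def WW_def W_def)
    \<comment> \<open>Every edge of \<open>M\<close> is in the ply of its own endpoints, so an
      endpoint inside the circumdisk and a vertex of \<open>K\<close> inside the diametral disk are
      both charged to a ply.\<close>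
    have crossing: "card {e\<in>M. K \<in> WW e} \<le> \<Delta> * card {i\<in>{1..n}. x i \<in> circumdisk K} + 3 * \<Delta>"
      if K: "K \<in> T" for K
    proof -
      obtain c r where cr: "K \<subseteq> sphere c r" "circumdisk K = ball c r"
        using ex_circumdisk[OF tri(2,3)[OF K]] .
      let ?X = "{i\<in>{1..n}. x i \<in> circumdisk K}"
      have sub: "{e\<in>M. K \<in> WW e} \<subseteq> (\<Union>i\<in>?X. ply (x i)) \<union> (\<Union>v\<in>K. ply v)"
      proof
        fix e assume "e \<in> {e\<in>M. K \<in> WW e}"
        then obtain i j z where e: "e \<in> M" "e = {i, j}" "z \<in> convex hull K"
          "z \<in> closed_segment (x i) (x j)" by (auto simp: WW_def W_def)
        then have ij: "i \<in> {1..n}" "j \<in> {1..n}" using Mij by auto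
        have plyI: "e \<in> ply v" if "(x i - v) \<bullet> (x j - v) \<le> 0" for v
          using e that by (auto simp: ply_def)
        show "e \<in> (\<Union>i\<in>?X. ply (x i)) \<union> (\<Union>v\<in>K. ply v)"
        proof (cases "x i \<in> circumdisk K \<or> x j \<in> circumdisk K")
          case True
          moreover have "e \<in> ply (x i)" "e \<in> ply (x j)" by (auto intro!: plyI)
          ultimately show ?thesis using ij by blast
        next
          case False
          then show ?thesis
            using ex_vertex_in_diametral_disk[OF cr(1) e(3,4)] plyI cr(2) by blast
        qed
      qed
      have "card {e\<in>M. K \<in> WW e} \<le> card ((\<Union>i\<in>?X. ply (x i)) \<union> (\<Union>v\<in>K. ply v))"
        using finply tri(5)[OF K] by (intro card_mono[OF _ sub]) auto
      also have "\<dots> \<le> card (\<Union>i\<in>?X. ply (x i)) + card (\<Union>v\<in>K. ply v)" by (rule card_Un_le)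
      also have "\<dots> \<le> (\<Sum>i\<in>?X. card (ply (x i))) + (\<Sum>v\<in>K. card (ply v))"
        using tri(5)[OF K] by (intro add_mono card_UN_le) auto
      also have "\<dots> \<le> (\<Sum>i\<in>?X. \<Delta>) + (\<Sum>v\<in>K. \<Delta>)"
        by (intro add_mono sum_mono ply)
      finally show ?thesis using tri(2)[OF K] by (simp add: mult.commute)
    qed
    have "card Z \<le> card (insert (1, \<tau> 1) (\<Union>e\<in>M. e \<times> WW e))" using finZ Zsub by (rule card_mono)
    also have "\<dots> \<le> Suc (card (\<Union>e\<in>M. e \<times> WW e))" by (rule card_insert_le_m1) auto
    also have "\<dots> \<le> Suc (\<Sum>e\<in>M. card (e \<times> WW e))" using card_UN_le[OF finM] by auto
    also have "(\<Sum>e\<in>M. card (e \<times> WW e)) = (\<Sum>e\<in>M. 2 * card (WW e))"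
      using M by (intro sum.cong) (auto simp: card_cartesian_product)
    also have "\<dots> = 2 * (\<Sum>e\<in>M. \<Sum>K\<in>T. if K \<in> WW e then 1 else 0)"
      using finT by (simp add: sum_distrib_left sum.If_cases WW_def Int_def)
    also have "(\<Sum>e\<in>M. \<Sum>K\<in>T. if K \<in> WW e then 1 else 0) = (\<Sum>K\<in>T. \<Sum>e\<in>M. if K \<in> WW e then 1 else 0)"
      by (rule sum.swap)
    also have "\<dots> = (\<Sum>K\<in>T. card {e\<in>M. K \<in> WW e})"
      using finM by (simp add: sum.If_cases Int_def)
    also have "\<dots> \<le> (\<Sum>K\<in>T. \<Delta> * card {i\<in>{1..n}. x i \<in> circumdisk K} + 3 * \<Delta>)"
      by (intro sum_mono crossing)
    finally have "card Z \<le> k" using k by simp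
    moreover have "finite Z" using Zsub finZ by (rule finite_subset)
    moreover have "(1, \<tau> 1) \<in> Z" by (simp add: Z_def)
    ultimately obtain w where w: "length w = Suc (2 * k)" "hd w = (1, \<tau> 1)"
      "successively (move M T) w" "set w = Z"
      using ex_covering_walk[OF _ _ move_refl move_sym reach[unfolded R_def]] by blast
    have "\<tau> 1 \<in> T" using \<tau> n by simp
    then have "location_of_marks n ((\<lambda>i. (i, \<tau> i)) ` {1..n}) \<in> encodings n T \<Delta> (insert {1, 2} (delaunay_graph n x)) k"
      unfolding encodings_def using ME deg w marks by blast
    then show "\<tau> \<in> encodings n T \<Delta> (insert {1, 2} (delaunay_graph n x)) k"
      using location_of_marks_graph[OF ext] by simp
  qed
qed

section \<open>Measurability and the entropy bound\<close>

lemma continuous_on_rot: "continuous_on UNIV rot"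
proof -
  have "linear rot" by (intro linearI) (simp_all add: rot_def vec_eq_iff forall_2)
  then show ?thesis by (simp add: linear_conv_bounded_linear linear_continuous_on)
qed

lemma measurable_rot [measurable]: "rot \<in> borel_measurable borel"
  using continuous_on_rot by (rule borel_measurable_continuous_onI)

lemma measurable_circumcenter [measurable (raw)]:
  assumes [measurable]: "f \<in> borel_measurable M" "g \<in> borel_measurable M" "h \<in> borel_measurable M"
  shows "(\<lambda>x. circumcenter (f x) (g x) (h x)) \<in> borel_measurable M"
  unfolding circumcenter_def by measurable

text \<open>Removes the definite description from the circumdisk, leaving comparisons of explicit
  measurable functions of the points.\<close>

lemma delaunay_triangle_iff:
  "delaunay_triangle P {a, b, c} \<longleftrightarrow> {a, b, c} \<subseteq> P \<and> rot (b - a) \<bullet> (c - a) \<noteq> 0 \<and>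
    (\<forall>p\<in>P. dist (circumcenter a b c) p \<ge> dist (circumcenter a b c) a)"
proof (cases "collinear {a, b, c}")
  case False
  then have "a \<noteq> b" "b \<noteq> c" "a \<noteq> c" by (auto simp: insert_commute)
  then have card: "card {a, b, c} = 3" by simp
  have "circumdisk {a, b, c} = ball (circumcenter a b c) (dist (circumcenter a b c) a)"
    using circumdisk_eq_ball[OF card False circumcenter_equidistant[OF False]] .
  then show ?thesis
    using False card by (auto simp: delaunay_triangle_def collinear_iff_rot disjoint_iff not_less)
qed (simp add: delaunay_triangle_def collinear_iff_rot)

text \<open>Replaces the quantifier over point sets by finite quantifiers over labels. Points are
  compared instead of labels, so that the equivalence also holds for inputs with repeated
  points.\<close>

lemma mem_delaunay_graph_iff:
  "e \<in> delaunay_graph n x \<longleftrightarrow> (\<exists>i\<in>{1..n}. \<exists>j\<in>{1..n}. e = {i, j} \<and> i \<noteq> j \<and>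
    (\<exists>a\<in>{1..n}. \<exists>b\<in>{1..n}. \<exists>c\<in>{1..n}. delaunay_triangle (x ` {1..n}) {x a, x b, x c} \<and>
      (x i = x a \<or> x i = x b \<or> x i = x c) \<and> (x j = x a \<or> x j = x b \<or> x j = x c)))"
proof -
  have *: "(\<exists>K. delaunay_triangle (x ` {1..n}) K \<and> x i \<in> K \<and> x j \<in> K) \<longleftrightarrow>
    (\<exists>a\<in>{1..n}. \<exists>b\<in>{1..n}. \<exists>c\<in>{1..n}. delaunay_triangle (x ` {1..n}) {x a, x b, x c} \<and>
      (x i = x a \<or> x i = x b \<or> x i = x c) \<and> (x j = x a \<or> x j = x b \<or> x j = x c))"
    (is "?L \<longleftrightarrow> ?R") for i j
  proof
    assume ?L
    then obtain K where K: "delaunay_triangle (x ` {1..n}) K" "x i \<in> K" "x j \<in> K" by blast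
    then have "card K = 3" "K \<subseteq> x ` {1..n}" by (auto simp: delaunay_triangle_def)
    then obtain p q r where pqr: "K = {p, q, r}" by (auto simp: card_3_iff)
    then have "p \<in> x ` {1..n}" "q \<in> x ` {1..n}" "r \<in> x ` {1..n}"
      using \<open>K \<subseteq> x ` {1..n}\<close> by auto
    then obtain a b c where abc: "a \<in> {1..n}" "b \<in> {1..n}" "c \<in> {1..n}" "K = {x a, x b, x c}"
      using pqr by blast
    have "x i = x a \<or> x i = x b \<or> x i = x c" "x j = x a \<or> x j = x b \<or> x j = x c"
      using K(2,3) unfolding abc(4) by simp_all
    then show ?R using abc(1-3) K(1)[unfolded abc(4)] by blast
  qed blast
  show ?thesis unfolding delaunay_graph_def mem_Collect_eq * by blast
qed

text \<open>The graph is determined by finitely many events, namely which label sets are its edges,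
  and each of them is measurable.\<close>

lemma simple_function_delaunay_graph:
  assumes X: "\<And>i. i \<in> {1..n} \<Longrightarrow> X i \<in> borel_measurable M"
  shows "simple_function M (\<lambda>\<omega>. delaunay_graph n (\<lambda>i. X i \<omega>))"
  unfolding simple_function_def
proof (intro conjI ballI)
  let ?G = "\<lambda>\<omega>. delaunay_graph n (\<lambda>i. X i \<omega>)"
  have sub: "?G \<omega> \<subseteq> Pow {1..n}" for \<omega> by (auto simp: delaunay_graph_def)
  then have "?G ` space M \<subseteq> Pow (Pow {1..n})" by blast
  then show "finite (?G ` space M)" by (rule finite_subset) simp
  have pred: "Measurable.pred M (\<lambda>\<omega>. e \<in> ?G \<omega>)" for e
  proof -
    have eq: "Measurable.pred M (\<lambda>\<omega>. X i \<omega> = X j \<omega>)" if "i \<in> {1..n}" "j \<in> {1..n}" for i j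
    proof -
      note [measurable] = X[OF that(1)] X[OF that(2)]
      show ?thesis by measurable
    qed
    have ori: "Measurable.pred M (\<lambda>\<omega>. rot (X b \<omega> - X a \<omega>) \<bullet> (X c \<omega> - X a \<omega>) \<noteq> 0)"
      if "a \<in> {1..n}" "b \<in> {1..n}" "c \<in> {1..n}" for a b c
    proof -
      note [measurable] = X[OF that(1)] X[OF that(2)] X[OF that(3)]
      show ?thesis by measurable
    qed
    have emp: "Measurable.pred M (\<lambda>\<omega>. dist (circumcenter (X a \<omega>) (X b \<omega>) (X c \<omega>)) (X l \<omega>)
        \<ge> dist (circumcenter (X a \<omega>) (X b \<omega>) (X c \<omega>)) (X a \<omega>))"
      if "a \<in> {1..n}" "b \<in> {1..n}" "c \<in> {1..n}" "l \<in> {1..n}" for a b c l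
    proof -
      note [measurable] = X[OF that(1)] X[OF that(2)] X[OF that(3)] X[OF that(4)]
      show ?thesis by measurable
    qed
    have tri: "Measurable.pred M (\<lambda>\<omega>. delaunay_triangle ((\<lambda>i. X i \<omega>) ` {1..n}) {X a \<omega>, X b \<omega>, X c \<omega>})"
      if abc: "a \<in> {1..n}" "b \<in> {1..n}" "c \<in> {1..n}" for a b c
    proof -
      have "delaunay_triangle ((\<lambda>i. X i \<omega>) ` {1..n}) {X a \<omega>, X b \<omega>, X c \<omega>} \<longleftrightarrow>
          rot (X b \<omega> - X a \<omega>) \<bullet> (X c \<omega> - X a \<omega>) \<noteq> 0 \<and>
          (\<forall>l\<in>{1..n}. dist (circumcenter (X a \<omega>) (X b \<omega>) (X c \<omega>)) (X l \<omega>)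
            \<ge> dist (circumcenter (X a \<omega>) (X b \<omega>) (X c \<omega>)) (X a \<omega>))" for \<omega>
        unfolding delaunay_triangle_iff using abc by simp
      then show ?thesis
        by (simp only:) (intro pred_intros_logic(3) ori[OF abc] pred_intros_finite(3)
          finite_atLeastAtMost emp[OF abc])
    qed
    show ?thesis
      unfolding mem_delaunay_graph_iff
      by (intro pred_intros_finite(4) pred_intros_conj1' pred_intros_logic(3,5) finite_atLeastAtMost tri eq)
  qed
  fix g assume g: "g \<in> ?G ` space M"
  then have "g \<subseteq> Pow {1..n}" using sub by blast
  then have "?G \<omega> = g \<longleftrightarrow> (\<forall>e\<in>Pow {1..n}. e \<in> ?G \<omega> \<longleftrightarrow> e \<in> g)" for \<omega>
    using sub[of \<omega>] by (simp only: set_eq_iff) (meson subsetD)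
  then have "?G -` {g} \<inter> space M = {\<omega>\<in>space M. \<forall>e\<in>Pow {1..n}. e \<in> ?G \<omega> \<longleftrightarrow> e \<in> g}"
    by (simp only: vimage_def singleton_iff) (simp add: Int_def conj_commute)
  also have "\<dots> \<in> sets M"
  proof (rule predE, rule pred_intros_finite(3))
    fix e
    have "Measurable.pred M (\<lambda>\<omega>. e \<in> g)" by simp
    then show "Measurable.pred M (\<lambda>\<omega>. e \<in> ?G \<omega> \<longleftrightarrow> e \<in> g)"
      by (intro pred_intros_logic(6) pred)
  qed simp
  finally show "?G -` {g} \<inter> space M \<in> sets M" .
qed

section \<open>Independence and expectations\<close>

lemma indep_vars_coordinates:
  assumes D: "\<And>i. i \<in> I \<Longrightarrow> prob_space (D i)" and "I \<noteq> {}"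
  shows "prob_space.indep_vars (PiM I D) D (\<lambda>i x. x i) I"
proof -
  interpret prob_space "PiM I D" using D by (rule prob_space_PiM)
  have "distr (PiM I D) (PiM I D) (\<lambda>x. \<lambda>i\<in>I. x i) = distr (PiM I D) (PiM I D) (\<lambda>x. x)"
    by (intro distr_cong) (auto simp: space_PiM)
  also have "\<dots> = PiM I D" by (rule distr_id)
  also have "\<dots> = PiM I (\<lambda>i. distr (PiM I D) (D i) (\<lambda>x. x i))"
    using D by (intro PiM_cong) (auto simp: distr_PiM_component)
  finally show ?thesis
    by (subst indep_vars_iff_distr_eq_PiM'[OF assms(2) measurable_component_singleton])
qed

text \<open>Needed to make the assumed expectations meaningful: the integral of a function that is
  not integrable is 0 by convention, and a bound on it would say nothing.\<close>

lemma integrable_conflict_count: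
  assumes "prob_space M" "\<And>i. i \<in> {1..n} \<Longrightarrow> (\<lambda>x. x i) \<in> borel_measurable M"
    and "open (circumdisk K)"
  shows "integrable M (conflict_count n K)"
proof -
  interpret prob_space M by fact
  have eq: "conflict_count n K x = (\<Sum>i\<in>{1..n}. indicator (circumdisk K) (x i))" for x
    by (simp add: conflict_count_def indicator_def sum.If_cases Int_def)
  have "(\<lambda>x. indicator (circumdisk K) (x i) :: real) \<in> borel_measurable M" if "i \<in> {1..n}" for i
  proof -
    have "(indicator (circumdisk K) :: point \<Rightarrow> real) \<in> borel_measurable borel"
      using assms(3) by (intro borel_measurable_indicator borel_open)
    from measurable_compose[OF assms(2)[OF that] this] show ?thesis .
  qed
  then have "integrable M (\<lambda>x. indicator (circumdisk K) (x i) :: real)" if "i \<in> {1..n}" for i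
    using that by (intro integrable_const_bound[of _ 1]) (auto simp: indicator_def)
  then show ?thesis unfolding eq by (intro Bochner_Integration.integrable_sum)
qed

theorem theorem4p5:
  fixes a b\<^sub>1 b\<^sub>2 :: real
  shows "\<exists>C. \<forall>n D W s V T \<tau>.
     n \<ge> 1 \<longrightarrow>
     admissible_dist n D W \<longrightarrow>
     learned_from n D W s V \<longrightarrow>
     real (card V) \<le> a * real n \<longrightarrow>
     delaunay_triangulation V T \<longrightarrow>
     (\<forall>K\<in>T. (\<integral>x. conflict_count n K x \<partial>input_dist n D) \<le> b\<^sub>1 \<and>
             (\<integral>x. (conflict_count n K x)\<^sup>2 \<partial>input_dist n D) \<le> b\<^sub>2) \<longrightarrow>
     (\<forall>i\<in>{1..n}. point_location (D i) T (\<tau> i)) \<longrightarrow>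
     (\<Sum>i = 1..n. shannon_entropy (input_dist n D) (\<lambda>x. \<tau> i (x i)))
       \<le> C * (real n + shannon_entropy (input_dist n D) (delaunay_graph n))"
proof -
  obtain \<Delta> where \<Delta>: "\<forall>n V T x \<tau> k.
    finite V \<longrightarrow> delaunay_triangulation V T \<longrightarrow> n \<ge> 1 \<longrightarrow>
    inj_on x {1..n} \<longrightarrow> general_position (x ` {1..n}) \<longrightarrow>
    \<tau> \<in> extensional {1..n} \<longrightarrow> (\<forall>i\<in>{1..n}. \<tau> i \<in> T \<and> x i \<in> convex hull (\<tau> i)) \<longrightarrow>
    1 + 2 * (\<Sum>K\<in>T. \<Delta> * card {i\<in>{1..n}. x i \<in> circumdisk K} + 3 * \<Delta>) \<le> k \<longrightarrow>
    \<tau> \<in> encodings n T \<Delta> (insert {1, 2} (delaunay_graph n x)) k"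
    using ex_encodings_constant ..
  \<comment> \<open>\<open>c * real n\<close> bounds the mean cost: there are at most
    \<open>2 * card V\<close> triangles, and each contributes twice its expected number of
    crossings. Absolute values are taken because \<open>a\<close> and \<open>b\<^sub>1\<close> come
    without a sign.\<close>
  define c where "c = 1 + 4 * \<bar>a\<bar> * (real \<Delta> * \<bar>b\<^sub>1\<bar> + 3 * real \<Delta>)"
  \<comment> \<open>One unit of \<open>k\<close> adds two steps with at most
    \<open>7 + \<Delta>\<close> choices each, and two mark bits.\<close>
  define B where "B = 4 * (7 + real \<Delta>)\<^sup>2"
  \<comment> \<open>\<open>19 = 1 + 18\<close>: the additive 1 of the entropy bound, and the
    exponent \<open>16 * n + 2\<close>, which is at most \<open>18 * n\<close>. The term with
    \<open>a\<close> pays for the initial triangle, the last one for the walk.\<close>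
  define C where "C = 19 + 2 * \<bar>a\<bar> + log 2 (2 * B) * c"
  have "(7 + real \<Delta>)\<^sup>2 \<ge> 1" by (rule one_le_power) simp
  then have B: "B \<ge> 1" unfolding B_def by linarith
  have c: "c \<ge> 1" by (simp add: c_def)
  have C: "C \<ge> 1" using B c by (simp add: C_def)
  show ?thesis
  proof (intro exI[of _ C] allI impI)
    fix n D W s V T \<tau>
    assume n: "n \<ge> (1::nat)" and adm: "admissible_dist n D W" and learned: "learned_from n D W s V"
      and cardV: "real (card V) \<le> a * real n" and dt: "delaunay_triangulation V T"
      and moments: "\<forall>K\<in>T. (\<integral>x. conflict_count n K x \<partial>input_dist n D) \<le> b\<^sub>1 \<and>
             (\<integral>x. (conflict_count n K x)\<^sup>2 \<partial>input_dist n D) \<le> b\<^sub>2"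
      and loc: "\<forall>i\<in>{1..n}. point_location (D i) T (\<tau> i)"
    let ?M = "input_dist n D" and ?G = "delaunay_graph n"
    have D: "prob_space (D i)" "sets (D i) = sets borel" if "i \<in> {1..n}" for i
      using adm that by (auto simp: admissible_dist_def)
    have spD: "space (D i) = UNIV" if "i \<in> {1..n}" for i
      using sets_eq_imp_space_eq[OF D(2)[OF that]] by simp
    have M: "prob_space ?M" unfolding input_dist_def using D(1) by (rule prob_space_PiM)
    interpret prob_space ?M by fact
    \<comment> \<open>The bound on \<open>card V\<close> is no evidence, since an infinite set has
      cardinality 0; finiteness comes from the finite sample.\<close>
    have finV: "finite V"
    proof -
      let ?L = "{1..nat \<lceil>log 2 (real n)\<rceil>}"
      obtain N where "disk_net (1 / real n) (?L \<times> {1..n}) (\<lambda>(l, i). s l i) N" and V: "V = N \<union> W"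
        using learned unfolding learned_from_def Let_def by blast
      then have "N \<subseteq> (\<lambda>(l, i). s l i) ` (?L \<times> {1..n})" unfolding disk_net_def by blast
      then have "finite N" by (rule finite_subset) simp
      moreover have "finite W"
        using adm by (auto simp: admissible_dist_def intro: card_ge_0_finite)
      ultimately show ?thesis by (simp add: V)
    qed
    note finT = finite_triangles[OF dt finV] and tri = triangleD[OF dt finV]
    have \<tau>: "\<tau> i \<in> measurable (D i) (count_space T)" "AE p in D i. p \<in> convex hull (\<tau> i p)"
      if "i \<in> {1..n}" for i
      using loc that by (auto simp: point_location_def)
    have \<tau>T: "\<tau> i p \<in> T" if "i \<in> {1..n}" for i p
      using measurable_space[OF \<tau>(1)[OF that], of p] spD[OF that] by simp
    have cardT: "real (card T) \<le> 2 * \<bar>a\<bar> * real n"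
    proof -
      have "real (card T) \<le> 2 * real (card V)"
        using card_triangulation_le[OF dt finV] by linarith
      also have "a * real n \<le> \<bar>a\<bar> * real n" by (intro mult_right_mono) auto
      then have "2 * real (card V) \<le> 2 * \<bar>a\<bar> * real n" using cardV by simp
      finally show ?thesis .
    qed
    have T_pos: "card T \<ge> 1"
      using \<tau>T[of 1] n finT by (auto simp: Suc_le_eq card_gt_0_iff)
    have coord: "(\<lambda>x. x i) \<in> borel_measurable ?M" if "i \<in> {1..n}" for i
    proof -
      have "(\<lambda>x. x i) \<in> measurable ?M (D i)"
        unfolding input_dist_def using that by (rule measurable_component_singleton)
      then show ?thesis by (simp cong: measurable_cong_sets add: D(2)[OF that])
    qed
    have G: "simple_function ?M ?G"
      using simple_function_delaunay_graph[of n "\<lambda>i x. x i" ?M] coord by simp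
    have \<tau>_UNIV: "\<tau> i \<in> measurable (D i) (count_space UNIV)" if "i \<in> {1..n}" for i
      by (rule measurable_compose[OF \<tau>(1)[OF that]]) simp
    have X_meas: "(\<lambda>x. \<tau> i (x i)) \<in> measurable ?M (count_space UNIV)" if "i \<in> {1..n}" for i
      unfolding input_dist_def by (rule measurable_compose[OF measurable_component_singleton[where M=D, OF that] \<tau>_UNIV[OF that]])
    have X: "simple_function ?M (\<lambda>x. \<tau> i (x i))" if "i \<in> {1..n}" for i
      unfolding simple_function_eq_measurable
      using X_meas[OF that] finT \<tau>T[OF that] by (auto intro: finite_subset[of _ T])
    have indep: "indep_vars (\<lambda>_. count_space UNIV) (\<lambda>i x. \<tau> i (x i)) {1..n}"
    proof -
      have "prob_space.indep_vars ?M D (\<lambda>i x. x i) {1..n}"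
        unfolding input_dist_def by (rule indep_vars_coordinates) (use D(1) n in auto)
      then show ?thesis
        by (rule indep_vars_compose2) (rule \<tau>_UNIV)
    qed
    define Y where "Y = (\<lambda>x. \<lambda>i\<in>{1..n}. \<tau> i (x i))"
    have I: "{1..n} \<noteq> {}" using n by simp
    have sumH: "(\<Sum>i = 1..n. shannon_entropy ?M (\<lambda>x. \<tau> i (x i))) = shannon_entropy ?M Y"
      and Y: "simple_function ?M Y"
      unfolding Y_def
      using sum_entropy_indep[OF M finite_atLeastAtMost I X indep] by auto
    define N where "N x = 1 + 2 * (\<Sum>K\<in>T. \<Delta> * card {i\<in>{1..n}. x i \<in> circumdisk K} + 3 * \<Delta>)"
      for x :: "nat \<Rightarrow> point"
    define A where "A = {x. inj_on x {1..n} \<and> general_position (x ` {1..n}) \<and>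
      (\<forall>i\<in>{1..n}. x i \<in> convex hull (\<tau> i (x i)))}"
    have good: "AE x in ?M. x \<in> A"
    proof -
      have "AE x in ?M. \<forall>i\<in>{1..n}. x i \<in> convex hull (\<tau> i (x i))"
      proof (subst AE_finite_all; (intro ballI)?)
        fix i assume i: "i \<in> {1..n}"
        show "AE x in ?M. x i \<in> convex hull (\<tau> i (x i))"
          unfolding input_dist_def
          using AE_PiM_component[where M=D and P="\<lambda>p. p \<in> convex hull (\<tau> i p)", OF D(1) i \<tau>(2)[OF i]] .
      qed simp
      moreover have "AE x in ?M. inj_on x {1..n} \<and> general_position (x ` {1..n}) \<and>
          x ` {1..n} \<subseteq> interior (convex hull W)"
        using adm by (simp add: admissible_dist_def)
      ultimately show ?thesis by eventually_elim (simp add: A_def)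
    qed
    have conflict: "integrable ?M (conflict_count n K)" if K: "K \<in> T" for K
    proof (rule integrable_conflict_count[OF M coord])
      obtain c r where "circumdisk K = ball c r" using ex_circumdisk[OF tri(2,3)[OF K]] .
      then show "open (circumdisk K)" by simp
    qed
    have realN: "real (N x) = 1 + 2 * (\<Sum>K\<in>T. real \<Delta> * conflict_count n K x + 3 * real \<Delta>)" for x
      by (simp add: N_def conflict_count_def)
    have intN: "integrable ?M (\<lambda>x. real (N x))"
      unfolding realN using conflict
      by (intro Bochner_Integration.integrable_add integrable_mult_right Bochner_Integration.integrable_sum integrable_const)
    have EN: "(\<integral>x. real (N x) \<partial>?M) \<le> c * real n"
    proof -
      have "(\<integral>x. real (N x) \<partial>?M)
          = 1 + 2 * (\<Sum>K\<in>T. real \<Delta> * (\<integral>x. conflict_count n K x \<partial>?M) + 3 * real \<Delta>)"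
        unfolding realN using conflict
        by (simp add: Bochner_Integration.integral_sum Bochner_Integration.integrable_sum prob_space)
      also have "\<dots> \<le> 1 + 2 * (\<Sum>K\<in>T. real \<Delta> * \<bar>b\<^sub>1\<bar> + 3 * real \<Delta>)"
        using moments by (intro add_left_mono mult_left_mono sum_mono add_right_mono) fastforce+
      also have "\<dots> = 1 + 2 * (real (card T) * (real \<Delta> * \<bar>b\<^sub>1\<bar> + 3 * real \<Delta>))" by simp
      also have "\<dots> \<le> real n + 2 * (2 * \<bar>a\<bar> * real n * (real \<Delta> * \<bar>b\<^sub>1\<bar> + 3 * real \<Delta>))"
        using n cardT by (intro add_mono mult_left_mono mult_right_mono) auto
      also have "\<dots> = c * real n" by (simp add: c_def algebra_simps)
      finally show ?thesis .
    qed
    \<comment> \<open>The exponent collects the at most \<open>16 * n\<close> edges of the graph,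
      the extra edge \<open>{1, 2}\<close> and the mark bit of the initial state.\<close>
    define K where "K = 2 ^ (16 * n + 2) * real (card T)"
    have "1 * 1 \<le> (2 ^ (16 * n + 2) :: real) * real (card T)"
      using T_pos by (intro mult_mono one_le_power) auto
    then have K: "K \<ge> 1" by (simp add: K_def)
    have enc: "{y. \<exists>x\<in>A. ?G x = g \<and> Y x = y \<and> N x \<le> k} \<subseteq> encodings n T \<Delta> (insert {1, 2} g) k"
      for g k
    proof
      fix y assume "y \<in> {y. \<exists>x\<in>A. ?G x = g \<and> Y x = y \<and> N x \<le> k}"
      then obtain x where x: "x \<in> A" "g = ?G x" "y = Y x" "N x \<le> k" by blast
      show "y \<in> encodings n T \<Delta> (insert {1, 2} g) k"
        unfolding x(2,3)
        using \<Delta>[rule_format, OF finV dt n, of x "Y x" k] x(1,4) \<tau>T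
        by (auto simp: A_def N_def Y_def)
    qed
    have count: "finite {y. \<exists>x\<in>A. ?G x = g \<and> Y x = y \<and> N x \<le> k} \<and>
        real (card {y. \<exists>x\<in>A. ?G x = g \<and> Y x = y \<and> N x \<le> k}) \<le> K * B ^ k" for g k
    \<comment> \<open>The bound on \<open>card g\<close> is available only for graphs of good
      inputs; for any other \<open>g\<close> there is nothing to count.\<close>
    proof (cases "\<exists>x\<in>A. ?G x = g")
      case True
      then obtain x where x: "x \<in> A" "?G x = g" by blast
      have g: "finite g" "card g \<le> 16 * n"
        using card_delaunay_graph_le[of x n] x by (auto simp: A_def)
      let ?E = "encodings n T \<Delta> (insert {1, 2} g) k"
      have E: "finite ?E" "card ?E \<le> 2 ^ card (insert {1, 2} g) * card T * (7 + \<Delta>) ^ (2 * k) * 2 ^ Suc (2 * k)"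
        using card_encodings_le[OF finT card_edge_neighbours_le[OF dt finV], of "insert {1, 2} g"] g(1)
        by auto
      have "card (insert {1, 2} g) \<le> 16 * n + 1"
        using g by (simp add: card_insert_if)
      then have "(2::nat) ^ card (insert {1, 2} g) \<le> 2 ^ (16 * n + 1)"
        by (rule power_increasing) simp
      then have "2 ^ card (insert {1, 2} g) * card T * (7 + \<Delta>) ^ (2 * k) * 2 ^ Suc (2 * k)
          \<le> 2 ^ (16 * n + 1) * card T * (7 + \<Delta>) ^ (2 * k) * 2 ^ Suc (2 * k)"
        by (intro mult_right_mono) auto
      with E(2) have "card ?E \<le> 2 ^ (16 * n + 1) * card T * (7 + \<Delta>) ^ (2 * k) * 2 ^ Suc (2 * k)"
        by (rule order_trans)
      then have "real (card ?E) \<le> real (2 ^ (16 * n + 1) * card T * (7 + \<Delta>) ^ (2 * k) * 2 ^ Suc (2 * k))"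
        by (rule of_nat_mono)
      also have "\<dots> = K * B ^ k"
        by (simp add: K_def B_def power_mult power_mult_distrib)
      finally show ?thesis
        using finite_subset[OF enc E(1)] card_mono[OF E(1) enc] by simp
    next
      case False
      then have "{y. \<exists>x\<in>A. ?G x = g \<and> Y x = y \<and> N x \<le> k} = {}" by blast
      then show ?thesis using K B by (simp only:) simp
    qed
    have "shannon_entropy ?M Y
        \<le> shannon_entropy ?M ?G + (1 + log 2 K + log 2 (2 * B) * (\<integral>x. real (N x) \<partial>?M))"
      by (rule entropy_encoding_bound[OF M G Y good B K intN]) (use count in auto)
    also have "1 + log 2 K + log 2 (2 * B) * (\<integral>x. real (N x) \<partial>?M)
        \<le> real n + (18 * real n + 2 * \<bar>a\<bar> * real n) + log 2 (2 * B) * (c * real n)"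
    proof (intro add_mono mult_left_mono EN)
      \<comment> \<open>A linear bound suffices, because naming the initial triangle may cost as
        much as \<open>O(n)\<close> bits.\<close>
      have "log 2 (real (card T)) \<le> real (card T)"
        using T_pos log2_of_power_less[of "card T" "card T"] less_exp[of "card T"] by simp
      moreover have "log 2 K = real (16 * n + 2) + log 2 (real (card T))"
      proof -
        have "log 2 (2 ^ (16 * n + 2)) = real (16 * n + 2)" by (rule log_pow_cancel) simp_all
        moreover have "log 2 K = log 2 (2 ^ (16 * n + 2)) + log 2 (real (card T))"
          unfolding K_def by (subst log_mult) (use T_pos in simp_all)
        ultimately show ?thesis by simp
      qed
      ultimately show "log 2 K \<le> 18 * real n + 2 * \<bar>a\<bar> * real n"
        using cardT n by simp
    qed (use n B in auto)
    also have "\<dots> = C * real n" by (simp add: C_def algebra_simps)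
    finally have "shannon_entropy ?M Y \<le> C * real n + 1 * shannon_entropy ?M ?G" by simp
    also have "\<dots> \<le> C * real n + C * shannon_entropy ?M ?G"
      using C shannon_entropy_nonneg[OF M G] by (intro add_left_mono mult_right_mono) auto
    finally show "(\<Sum>i = 1..n. shannon_entropy ?M (\<lambda>x. \<tau> i (x i)))
       \<le> C * (real n + shannon_entropy ?M ?G)"
      unfolding sumH by (simp add: distrib_left)
  qed
qed

end
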